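(* Let $G=(V,E)$ be a finite graph of maximum degree at most $\Delta$, with a partition of its vertices into blocks $V=V_1\sqcup\dots\sqcup V_k$, each of size exactly $b\ge1$, where $b\ge4\Delta$. Let $\alpha=\sqrt{1-4\Delta/b}$. Then for any $L\subseteq V$, the independent transversal $T$ produced by the MT algorithm satisfies $$\Pr_{\mathrm{MT}}(L\cap T\ne\emptyset)\ \le\ \max\Bigl(\frac{2|L|}{b+|L|+(b-|L|)\alpha},\ \frac{2\,(1-e^{-|L|/b})}{1+\alpha}\Bigr).$$
   Context: An independent transversal of $G$ with respect to $V_1,\dots,V_k$ is an independent set $T$ of $G$ with $|T\cap V_i|=1$ for all $i$. MT (Moser–Tardos) algorithm in this setting: for each $i=1,\dots,k$ independently choose $X(i)\in V_i$ uniformly at random, and let $T=\{X(1),\dots,X(k)\}$. There is one bad-event for each edge, namely that both of its endpoints are in $T$. While some bad-event is true, choose an edge with both endpoints in $T$ (by an arbitrary fixed, possibly randomized, rule) and resample $X(i)$, independently and uniformly from $V_i$, for each block $V_i$ containing an endpoint of this edge. When $b\ge4\Delta$ this terminates with probability one, and the final $T$ is an independent transversal. $\Pr_{\mathrm{MT}}$ denotes probability with respect to the distribution of the final $T$; the result holds for every choice of selection rule. *)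

theory Defs
  imports Complex_Main "HOL-Probability.SPMF" "HOL-Probability.Product_PMF"
begin

text \<open>
  Finite simple graphs are given by a vertex set and a set of two-element edges.
  The blocks are \<open>B 1, \<dots>, B k\<close>, and a configuration \<open>X :: nat \<Rightarrow> 'v\<close> records the vertex
  \<open>X i\<close> currently chosen from block \<open>B i\<close> for \<open>i \<in> {1..k}\<close>.
\<close>

definition simple_graph :: "'v set \<Rightarrow> 'v set set \<Rightarrow> bool" where
  "simple_graph V E \<longleftrightarrow> finite V \<and> (\<forall>e\<in>E. e \<subseteq> V \<and> card e = 2)"

definition vertex_degree :: "'v set set \<Rightarrow> 'v \<Rightarrow> nat" where
  "vertex_degree E v = card {e \<in> E. v \<in> e}"

definition independent_set :: "'v set \<Rightarrow> 'v set set \<Rightarrow> 'v set \<Rightarrow> bool" where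
  "independent_set V E T \<longleftrightarrow> T \<subseteq> V \<and> (\<forall>e\<in>E. \<not> e \<subseteq> T)"

definition independent_transversal ::
    "'v set \<Rightarrow> 'v set set \<Rightarrow> (nat \<Rightarrow> 'v set) \<Rightarrow> nat \<Rightarrow> 'v set \<Rightarrow> bool" where
  "independent_transversal V E B k T \<longleftrightarrow>
     independent_set V E T \<and> (\<forall>i\<in>{1..k}. card (T \<inter> B i) = 1)"

definition block_partition :: "'v set \<Rightarrow> (nat \<Rightarrow> 'v set) \<Rightarrow> nat \<Rightarrow> bool" where
  "block_partition V B k \<longleftrightarrow> V = (\<Union>i\<in>{1..k}. B i) \<and> disjoint_family_on B {1..k}"

definition chosen :: "nat \<Rightarrow> (nat \<Rightarrow> 'v) \<Rightarrow> 'v set" where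
  "chosen k X = X ` {1..k}"

definition bad_edges :: "'v set set \<Rightarrow> nat \<Rightarrow> (nat \<Rightarrow> 'v) \<Rightarrow> 'v set set" where
  "bad_edges E k X = {e \<in> E. e \<subseteq> chosen k X}"

definition mt_init :: "(nat \<Rightarrow> 'v set) \<Rightarrow> nat \<Rightarrow> (nat \<Rightarrow> 'v) pmf" where
  "mt_init B k = Pi_pmf {1..k} undefined (\<lambda>i. pmf_of_set (B i))"

definition mt_resample ::
    "(nat \<Rightarrow> 'v set) \<Rightarrow> nat \<Rightarrow> 'v set \<Rightarrow> (nat \<Rightarrow> 'v) \<Rightarrow> (nat \<Rightarrow> 'v) pmf" where
  "mt_resample B k e X =
     (let J = {i \<in> {1..k}. B i \<inter> e \<noteq> {}}
      in map_pmf (\<lambda>Y. override_on X Y J) (Pi_pmf J undefined (\<lambda>i. pmf_of_set (B i))))"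

text \<open>
  A selection rule may be randomized and may depend on the whole past of the run, given as the
  chronological list of previous configurations and the edges selected in them.
\<close>

type_synonym 'v history = "((nat \<Rightarrow> 'v) \<times> 'v set) list"

type_synonym 'v rule = "'v history \<Rightarrow> (nat \<Rightarrow> 'v) \<Rightarrow> 'v set pmf"

definition selection_rule :: "'v set set \<Rightarrow> nat \<Rightarrow> 'v rule \<Rightarrow> bool" where
  "selection_rule E k R \<longleftrightarrow>
     (\<forall>h X. bad_edges E k X \<noteq> {} \<longrightarrow> set_pmf (R h X) \<subseteq> bad_edges E k X)"

text \<open>
  The loop is the least fixed point in the sub-probability monad: the mass missing from
  its value is the probability that the loop does not terminate.
\<close>

partial_function (spmf) mt_loop ::
    "'v set set \<Rightarrow> (nat \<Rightarrow> 'v set) \<Rightarrow> nat \<Rightarrow> 'v rule \<Rightarrow> 'v history \<Rightarrow> (nat \<Rightarrow> 'v) \<Rightarrow> (nat \<Rightarrow> 'v) spmf"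
where
  "mt_loop E B k R h X =
     (if bad_edges E k X = {} then return_spmf X
      else bind_spmf (spmf_of_pmf (R h X)) (\<lambda>e.
           bind_spmf (spmf_of_pmf (mt_resample B k e X)) (\<lambda>X'.
           mt_loop E B k R (h @ [(X, e)]) X')))"

definition mt_transversal ::
    "'v set set \<Rightarrow> (nat \<Rightarrow> 'v set) \<Rightarrow> nat \<Rightarrow> 'v rule \<Rightarrow> 'v set spmf" where
  "mt_transversal E B k R =
     map_spmf (chosen k) (bind_spmf (spmf_of_pmf (mt_init B k)) (mt_loop E B k R []))"

lemma mt_loop_sound:
  assumes fin: "\<And>i. i \<in> {1..k} \<Longrightarrow> finite (B i) \<and> B i \<noteq> {}"
    and X: "\<forall>i\<in>{1..k}. X i \<in> B i"
    and Y: "Y \<in> set_spmf (mt_loop E B k R h X)"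
  shows "(\<forall>i\<in>{1..k}. Y i \<in> B i) \<and> bad_edges E k Y = {}"
proof -
  have res: "\<forall>i\<in>{1..k}. X' i \<in> B i"
    if X'_in: "X' \<in> set_pmf (mt_resample B k e X)" and X_in: "\<forall>i\<in>{1..k}. X i \<in> B i" for e X X'
  proof
    fix i assume i: "i \<in> {1..k}"
    define J where "J = {i \<in> {1..k}. B i \<inter> e \<noteq> {}}"
    have "finite J" "J \<subseteq> {1..k}"
      by (auto simp: J_def)
    obtain Y where Y: "Y \<in> set_pmf (Pi_pmf J undefined (\<lambda>i. pmf_of_set (B i)))"
      and X': "X' = override_on X Y J"
      using X'_in unfolding mt_resample_def Let_def J_def[symmetric] by auto
    have "set_pmf (pmf_of_set (B i)) = B i"
      using fin[OF i] by (simp add: set_pmf_of_set)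
    then have "Y i \<in> B i" if "i \<in> J"
      using Y that \<open>finite J\<close> by (auto simp: set_Pi_pmf PiE_dflt_def)
    then show "X' i \<in> B i"
      using X_in i X' by (cases "i \<in> J") auto
  qed
  have "\<forall>h X. (\<forall>i\<in>{1..k}. X i \<in> B i) \<longrightarrow>
      (\<forall>Y\<in>set_spmf (mt_loop E B k R h X). (\<forall>i\<in>{1..k}. Y i \<in> B i) \<and> bad_edges E k Y = {})"
    (is "?P mt_loop")
  proof (rule mt_loop.fixp_induct[where P = ?P])
    show "spmf.admissible (\<lambda>f. ?P (curry (curry (curry (curry (curry f))))))"
      unfolding curry_def by simp
    show "?P (\<lambda>E B k R h X. return_pmf None)"
      by simp
  next
    fix f assume IH: "?P f"
    show "?P (\<lambda>E B k R h X.
       if bad_edges E k X = {} then return_spmf X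
       else bind_spmf (spmf_of_pmf (R h X)) (\<lambda>e.
            bind_spmf (spmf_of_pmf (mt_resample B k e X)) (f E B k R (h @ [(X, e)]))))"
    proof (intro allI impI ballI)
      fix h X Y
      assume X: "\<forall>i\<in>{1..k}. X i \<in> B i"
        and Y: "Y \<in> set_spmf (if bad_edges E k X = {} then return_spmf X
          else bind_spmf (spmf_of_pmf (R h X)) (\<lambda>e.
               bind_spmf (spmf_of_pmf (mt_resample B k e X)) (f E B k R (h @ [(X, e)]))))"
      show "(\<forall>i\<in>{1..k}. Y i \<in> B i) \<and> bad_edges E k Y = {}"
      proof (cases "bad_edges E k X = {}")
        case True
        with X Y show ?thesis by simp
      next
        case False
        with Y obtain e X' where "X' \<in> set_pmf (mt_resample B k e X)"
          and "Y \<in> set_spmf (f E B k R (h @ [(X, e)]) X')"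
          unfolding set_bind_spmf bind_UNION set_spmf_spmf_of_pmf o_def if_not_P[OF False] by blast
        with IH res X show ?thesis by blast
      qed
    qed
  qed
  then show ?thesis
    using X Y by blast
qed

lemma mt_transversal_sound:
  assumes "simple_graph V E" "block_partition V B k" "b \<ge> 1"
    and "\<And>i. i \<in> {1..k} \<Longrightarrow> card (B i) = b"
    and "T \<in> set_spmf (mt_transversal E B k R)"
  shows "independent_transversal V E B k T"
proof -
  have fin: "finite (B i) \<and> B i \<noteq> {}" if "i \<in> {1..k}" for i
    using assms(3) assms(4)[OF that] by (metis card.empty card.infinite not_one_le_zero)
  obtain X0 X where X0: "X0 \<in> set_pmf (mt_init B k)"
    and X: "X \<in> set_spmf (mt_loop E B k R [] X0)" and T: "T = chosen k X"
    using assms(5)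
    unfolding mt_transversal_def set_map_spmf set_bind_spmf bind_UNION set_spmf_spmf_of_pmf o_def
    by blast
  have "\<forall>i\<in>{1..k}. X0 i \<in> B i"
    using X0 fin by (auto simp: mt_init_def set_Pi_pmf PiE_dflt_def)
  then have XB: "\<forall>i\<in>{1..k}. X i \<in> B i" and bad: "bad_edges E k X = {}"
    using mt_loop_sound[OF fin _ X] by blast+
  have "T \<inter> B i = {X i}" if i: "i \<in> {1..k}" for i
  proof -
    have "j = i" if "j \<in> {1..k}" "X j \<in> B i" for j
      using disjoint_family_onD[of B "{1..k}" j i] assms(2) XB[rule_format, OF that(1)] that i
      by (auto simp: block_partition_def)
    with XB i show ?thesis
      unfolding T chosen_def by blast
  qed
  then show ?thesis
    using XB bad assms(2)
    by (auto simp: independent_transversal_def independent_set_def bad_edges_def T chosen_def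
        block_partition_def)
qed

end

theory Submission
  imports Defs
begin

text \<open>
  A run of the algorithm from a configuration \<open>X\<close> is controlled by a potential: a sum over heaps of
  edges (histories up to commutation of block-disjoint resamplings) of the probability that a fresh
  table of block values, with first row \<open>X\<close>, is compatible with the heap. Resampling an edge \<open>e\<close>
  pushes \<open>e\<close> below the heap, so the potential is a supermartingale for every selection rule, and its
  initial mean is bounded by the cluster expansion with fugacity \<open>1 / b\<^sup>2\<close>. Rooted at a block with
  trivial weight, it bounds the expected number of resamplings, which gives termination.

  Up to the first time that \<open>T\<close> meets \<open>L\<close>, every resampled edge avoids \<open>L\<close>. So only such edges enter
  the heaps; with \<open>p\<^sub>i = |L \<inter> V\<^sub>i| / b\<close>, \<open>y = 2 / (1 + \<alpha>)\<close> and \<open>x = y - 1\<close>, a root in block \<open>i\<close>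
  costs at most \<open>y / (1 + p\<^sub>i x)\<close>. If \<open>i\<close> is the smallest index at which \<open>L\<close> is hit, then each block
  \<open>j < i\<close> contributes moreover a factor \<open>1 - p\<^sub>j\<close>. With \<open>\<theta>\<^sub>i = p\<^sub>i / (1 + p\<^sub>i x) \<le> p\<^sub>i\<close> the
  sum over \<open>i\<close> telescopes to \<open>y (1 - \<Prod>\<^sub>i (1 - \<theta>\<^sub>i))\<close>. For fixed \<open>\<Sum>\<^sub>i p\<^sub>i\<close> this is at
  most its value when \<open>L\<close> lies in one block or its limit when \<open>L\<close> is spread out evenly, and these
  are the two terms of the maximum.
\<close>

subsection \<open>Averages over block resamplings\<close>

lemma expectation_bind_finite:
  fixes h :: "'b \<Rightarrow> real"
  assumes "finite (set_pmf p)" and "\<And>x. x \<in> set_pmf p \<Longrightarrow> finite (set_pmf (f x))"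
  shows "measure_pmf.expectation (bind_pmf p f) h =
    measure_pmf.expectation p (\<lambda>x. measure_pmf.expectation (f x) h)"
  using pmf_expectation_bind[OF assms(1), of f p h] assms
  by (simp add: integral_measure_pmf[OF assms(1)])

lemma expectation_mono_finite:
  fixes f g :: "'a \<Rightarrow> real"
  assumes "finite (set_pmf p)" and "\<And>x. x \<in> set_pmf p \<Longrightarrow> f x \<le> g x"
  shows "measure_pmf.expectation p f \<le> measure_pmf.expectation p g"
  using assms by (intro integral_mono_AE integrable_measure_pmf_finite) (auto simp: AE_measure_pmf_iff)

locale blocks =
  fixes B :: "nat \<Rightarrow> 'v set" and k b :: nat
  assumes b_pos: "b \<ge> 1"
    and card_block: "\<And>i. i \<in> {1..k} \<Longrightarrow> card (B i) = b"
    and disjoint_blocks: "disjoint_family_on B {1..k}"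
begin

lemma finite_block: "i \<in> {1..k} \<Longrightarrow> finite (B i)"
  and block_nonempty: "i \<in> {1..k} \<Longrightarrow> B i \<noteq> {}"
  using card_block b_pos by (metis card.infinite not_one_le_zero, metis card.empty not_one_le_zero)

definition touched :: "'v set \<Rightarrow> nat set" where
  "touched M = {i \<in> {1..k}. B i \<inter> M \<noteq> {}}"

definition block_pmf :: "nat set \<Rightarrow> (nat \<Rightarrow> 'v) pmf" where
  "block_pmf J = Pi_pmf J undefined (\<lambda>i. pmf_of_set (B i))"

definition avg :: "nat set \<Rightarrow> ((nat \<Rightarrow> 'v) \<Rightarrow> real) \<Rightarrow> (nat \<Rightarrow> 'v) \<Rightarrow> real" where
  "avg J g X = measure_pmf.expectation (block_pmf J) (\<lambda>Y. g (override_on X Y J))"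

text \<open>Stated for arbitrary sets, so that \<open>M\<close> can be a single edge or the union of
  a whole layer of edges.\<close>

definition covers :: "'v set \<Rightarrow> (nat \<Rightarrow> 'v) \<Rightarrow> bool" where
  "covers M X \<longleftrightarrow> (\<forall>i\<in>touched M. X i \<in> B i \<inter> M)"

text \<open>One resampling as an operator on functions of the current row: the indicator tests
  whether the row shows \<open>M\<close>, and the average puts fresh values into the touched
  blocks.\<close>

definition step :: "'v set \<Rightarrow> ((nat \<Rightarrow> 'v) \<Rightarrow> real) \<Rightarrow> (nat \<Rightarrow> 'v) \<Rightarrow> real" where
  "step M g X = of_bool (covers M X) * avg (touched M) g X"

lemma touched_subset: "touched M \<subseteq> {1..k}"
  by (auto simp: touched_def)

lemma finite_touched [simp]: "finite (touched M)"
  using finite_subset[OF touched_subset] by blast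

lemma touched_Un: "touched (M \<union> N) = touched M \<union> touched N"
  by (auto simp: touched_def)

lemma touched_empty [simp]: "touched {} = {}"
  by (simp add: touched_def)

lemma set_block_pmf:
  assumes "J \<subseteq> {1..k}"
  shows "set_pmf (block_pmf J) = PiE_dflt J undefined B"
proof -
  have "finite J" using assms finite_subset by blast
  moreover have "set_pmf (pmf_of_set (B i)) = B i" if "i \<in> J" for i
    using assms that finite_block block_nonempty by (meson set_pmf_of_set subsetD)
  ultimately show ?thesis
    unfolding block_pmf_def by (auto simp: set_Pi_pmf PiE_dflt_def)
qed

lemma finite_block_pmf:
  assumes "J \<subseteq> {1..k}"
  shows "finite (set_pmf (block_pmf J))"
  unfolding set_block_pmf[OF assms] using assms finite_block
  by (intro finite_PiE_dflt) (auto intro: finite_subset)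

lemma avg_empty [simp]: "avg {} g = g"
  by (simp add: avg_def[abs_def] block_pmf_def)

lemma avg_avg:
  assumes "J \<subseteq> {1..k}" "K \<subseteq> {1..k}" "J \<inter> K = {}"
  shows "avg J (avg K g) = avg (J \<union> K) g"
proof
  fix X
  have fin: "finite J" "finite K" using assms finite_subset by blast+
  have ov: "override_on X (\<lambda>x. if x \<in> J then Y x else Z x) (J \<union> K)
      = override_on (override_on X Y J) Z K" for Y Z :: "nat \<Rightarrow> 'v"
    using assms(3) by (fastforce simp: override_on_def fun_eq_iff)
  have "avg (J \<union> K) g X = measure_pmf.expectation (pair_pmf (block_pmf J) (block_pmf K))
      (\<lambda>(Y, Z). g (override_on (override_on X Y J) Z K))"
    unfolding avg_def block_pmf_def
    by (simp add: Pi_pmf_union[OF fin assms(3)] ov split_def)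
  also have "\<dots> = avg J (avg K g) X"
    unfolding avg_def pair_pmf_def
    by (simp add: expectation_bind_finite finite_block_pmf[OF assms(1)] finite_block_pmf[OF assms(2)])
  finally show "avg J (avg K g) X = avg (J \<union> K) g X" ..
qed

lemma avg_mult_indep:
  assumes "\<And>X Y. g (override_on X Y J) = g X"
  shows "avg J (\<lambda>X. f X * g X) X = avg J f X * g X"
  by (simp add: avg_def assms)

lemma avg_override: "avg J g (override_on X Y J) = avg J g X"
proof -
  have "override_on (override_on X Y J) Z J = override_on X Z J" for Z :: "nat \<Rightarrow> 'v"
    by (auto simp: override_on_def)
  then show ?thesis by (simp add: avg_def)
qed

lemma avg_mono:
  assumes "J \<subseteq> {1..k}" "\<And>X. f X \<le> g X"
  shows "avg J f X \<le> avg J g X"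
  unfolding avg_def by (intro expectation_mono_finite finite_block_pmf assms)

lemma avg_nonneg: "(\<And>X. g X \<ge> 0) \<Longrightarrow> avg J g X \<ge> 0"
  by (simp add: avg_def)

lemma avg_const [simp]: "avg J (\<lambda>_. c) X = c"
  by (simp add: avg_def)

lemma avg_sum:
  assumes "J \<subseteq> {1..k}"
  shows "avg J (\<lambda>X. \<Sum>a\<in>A. f a X) X = (\<Sum>a\<in>A. avg J (f a) X)"
  unfolding avg_def
  by (intro Bochner_Integration.integral_sum integrable_measure_pmf_finite finite_block_pmf assms)

lemma avg_add:
  assumes "J \<subseteq> {1..k}"
  shows "avg J (\<lambda>X. f X + g X) X = avg J f X + avg J g X"
  unfolding avg_def
  by (intro Bochner_Integration.integral_add integrable_measure_pmf_finite finite_block_pmf assms)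

lemma avg_indicator:
  assumes "J \<subseteq> {1..k}"
  shows "avg J (\<lambda>X. of_bool (\<forall>i\<in>J. X i \<in> D i)) X = (\<Prod>i\<in>J. real (card (B i \<inter> D i)) / real b)"
proof -
  have "finite J" using assms finite_subset by blast
  have "avg J (\<lambda>X. of_bool (\<forall>i\<in>J. X i \<in> D i)) X
      = measure_pmf.expectation (block_pmf J) (indicator (Pi J D))"
    unfolding avg_def by (intro arg_cong2[where f = lebesgue_integral])
      (auto simp: fun_eq_iff indicator_def Pi_def)
  also have "\<dots> = measure_pmf.prob (block_pmf J) (Pi J D)"
    by simp
  also have "\<dots> = (\<Prod>i\<in>J. measure_pmf.prob (pmf_of_set (B i)) (D i))"
    unfolding block_pmf_def by (rule measure_Pi_pmf_Pi[OF \<open>finite J\<close>])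
  also have "\<dots> = (\<Prod>i\<in>J. real (card (B i \<inter> D i)) / real b)"
    using assms finite_block block_nonempty card_block
    by (intro prod.cong refl) (metis measure_pmf_of_set subsetD)
  finally show ?thesis .
qed

lemma covers_override:
  assumes "touched M \<inter> J = {}"
  shows "covers M (override_on X Y J) = covers M X"
proof -
  have "override_on X Y J i = X i" if "i \<in> touched M" for i
    using assms that by (auto simp: override_on_def)
  then show ?thesis by (simp add: covers_def)
qed

lemma covers_Un:
  assumes "touched M \<inter> touched N = {}"
  shows "covers (M \<union> N) X \<longleftrightarrow> covers M X \<and> covers N X"
proof -
  have "B i \<inter> (M \<union> N) = B i \<inter> M" if "i \<in> touched M" for i
    using assms that unfolding touched_def by blast
  moreover have "B i \<inter> (M \<union> N) = B i \<inter> N" if "i \<in> touched N" for i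
    using assms that unfolding touched_def by blast
  ultimately show ?thesis
    unfolding covers_def touched_Un by blast
qed

text \<open>The two operators act on disjoint coordinates, so averaging over the blocks of
  \<open>M\<close> leaves the test for \<open>N\<close> unchanged. In particular such steps
  commute.\<close>

lemma step_step:
  assumes "touched M \<inter> touched N = {}"
  shows "step M (step N g) = step (M \<union> N) g"
proof
  fix X
  have "avg (touched M) (step N g) X = avg (touched M) (\<lambda>X. avg (touched N) g X * of_bool (covers N X)) X"
    by (simp add: step_def[abs_def] mult.commute)
  also have "\<dots> = avg (touched M) (avg (touched N) g) X * of_bool (covers N X)"
    using assms by (intro avg_mult_indep) (simp add: covers_override Int_commute)
  finally show "step M (step N g) X = step (M \<union> N) g X"
    using avg_avg[OF touched_subset touched_subset assms]
    by (simp add: step_def covers_Un[OF assms] touched_Un)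
qed

lemma step_empty [simp]: "step {} g = g"
  by (simp add: step_def[abs_def] covers_def)

lemma step_nonneg: "(\<And>X. g X \<ge> 0) \<Longrightarrow> step M g X \<ge> 0"
  by (simp add: step_def avg_nonneg)

lemma step_mono: "(\<And>X. f X \<le> g X) \<Longrightarrow> step M f X \<le> step M g X"
  by (simp add: step_def avg_mono[OF touched_subset])

lemma step_sum: "step M (\<lambda>X. \<Sum>a\<in>A. f a X) X = (\<Sum>a\<in>A. step M (f a) X)"
  by (simp add: step_def avg_sum[OF touched_subset] sum_distrib_left)

text \<open>Under a uniform row the test for \<open>M\<close> is independent of the mean taken after
  resampling, since the latter does not read the old values of the touched blocks.\<close>

lemma avg_all_step:
  "avg {1..k} (step M g) X
    = (\<Prod>i\<in>touched M. real (card (B i \<inter> M)) / real b) * avg {1..k} g X"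
proof -
  define J where "J = touched M"
  define K where "K = {1..k} - J"
  have J: "J \<subseteq> {1..k}" and K: "K \<subseteq> {1..k}" "K \<inter> J = {}" and KJ: "K \<union> J = {1..k}"
    using touched_subset by (auto simp: J_def K_def)
  have split: "avg {1..k} h = avg K (avg J h)" for h
    using avg_avg[OF K(1) J K(2)] KJ by simp
  have "avg J (step M g) X = avg J (\<lambda>X. of_bool (covers M X)) X * avg J g X" for X
    unfolding step_def J_def[symmetric] by (rule avg_mult_indep) (rule avg_override)
  moreover have "avg J (\<lambda>X. of_bool (covers M X)) X = (\<Prod>i\<in>J. real (card (B i \<inter> M)) / real b)" for X
  proof -
    have "avg J (\<lambda>X. of_bool (covers M X)) X = avg J (\<lambda>X. of_bool (\<forall>i\<in>J. X i \<in> B i \<inter> M)) X"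
      by (simp add: covers_def J_def)
    then show ?thesis
      unfolding avg_indicator[OF J] by simp
  qed
  ultimately have "avg J (step M g) = (\<lambda>X. (\<Prod>i\<in>J. real (card (B i \<inter> M)) / real b) * avg J g X)"
    by (simp add: fun_eq_iff)
  then show ?thesis
    unfolding split by (simp add: avg_def[of K] J_def)
qed

end

subsection \<open>Heaps of edges and the cluster expansion\<close>

locale conflict_edges = blocks +
  fixes F :: "'a set set"
  assumes finite_edges: "finite F"
    and card_touched: "\<And>e. e \<in> F \<Longrightarrow> card (touched e) = 2"
    and card_block_edge: "\<And>e i. e \<in> F \<Longrightarrow> i \<in> touched e \<Longrightarrow> card (B i \<inter> e) = 1"
begin

definition stable :: "'a set set \<Rightarrow> bool" where
  "stable S \<longleftrightarrow> (\<forall>e\<in>S. \<forall>f\<in>S. e \<noteq> f \<longrightarrow> touched e \<inter> touched f = {})"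

definition layer_sets :: "nat set \<Rightarrow> 'a set set set" where
  "layer_sets U = {S. S \<subseteq> F \<and> stable S \<and> (\<forall>e\<in>S. touched e \<inter> U \<noteq> {})}"

text \<open>Heaps in normal form, listed from the root: each layer is a set of block-disjoint edges, all
  of which meet a block of the preceding layer, so every edge sits as close to the root as possible.
  The root comes last in time. Layers may be empty, which makes all heaps of height at most \<open>n\<close>
  lists of length \<open>n\<close>.\<close>

fun layers :: "nat \<Rightarrow> nat set \<Rightarrow> 'a set set list set" where
  "layers 0 U = {[]}"
| "layers (Suc n) U =
    (\<lambda>(S, t). S # t) ` Sigma (layer_sets U) (\<lambda>S. layers n (touched (\<Union>S)))"

definition separate :: "'a set \<Rightarrow> 'a set set list \<Rightarrow> bool" where
  "separate e t \<longleftrightarrow> (\<forall>S\<in>set t. touched e \<inter> touched (\<Union>S) = {})"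

text \<open>The new edge precedes the whole heap in time, so it starts at the far end and slides
  towards the root past layers with which it shares no block. The padding makes the length grow by
  one in every case.\<close>

fun push :: "'a set \<Rightarrow> 'a set set list \<Rightarrow> 'a set set list" where
  "push e [] = [{e}]"
| "push e (S # t) = (if separate e (S # t) then insert e S # t @ [{}] else S # push e t)"

text \<open>The root layer acts innermost because it is last in time; the far end of the list meets
  the current row first.\<close>

fun replay :: "'a set set list \<Rightarrow> ((nat \<Rightarrow> 'a) \<Rightarrow> real) \<Rightarrow> (nat \<Rightarrow> 'a) \<Rightarrow> real" where
  "replay [] g = g"
| "replay (S # t) g = replay t (step (\<Union>S) g)"

definition heap_size :: "'a set set list \<Rightarrow> nat" where
  "heap_size t = (\<Sum>S\<leftarrow>t. card S)"

definition mass :: "nat \<Rightarrow> nat set \<Rightarrow> real" where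
  "mass n U = (\<Sum>t\<in>layers n U. (1 / real b ^ 2) ^ heap_size t)"

definition potential :: "nat \<Rightarrow> nat \<Rightarrow> ((nat \<Rightarrow> 'a) \<Rightarrow> real) \<Rightarrow> (nat \<Rightarrow> 'a) \<Rightarrow> real" where
  "potential n i g X = (\<Sum>t\<in>layers n {i}. replay t g X)"

section \<open>Combinatorics of heaps and of pushing an edge\<close>

lemma touched_Union: "touched (\<Union>S) = (\<Union>f\<in>S. touched f)"
  by (auto simp: touched_def)

lemma touched_nonempty: "e \<in> F \<Longrightarrow> touched e \<noteq> {}"
  using card_touched by fastforce

lemma finite_layer_sets: "finite (layer_sets U)"
  by (rule finite_subset[of _ "Pow F"]) (auto simp: layer_sets_def finite_edges)

lemma layer_setsD: "S \<in> layer_sets U \<Longrightarrow> S \<subseteq> F" "S \<in> layer_sets U \<Longrightarrow> stable S"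
  by (auto simp: layer_sets_def)

lemma finite_layers: "finite (layers n U)"
  by (induction n arbitrary: U) (auto simp: finite_layer_sets)

lemma sum_layers_Suc:
  fixes h :: "'a set set list \<Rightarrow> real"
  shows "(\<Sum>t\<in>layers (Suc n) U. h t)
    = (\<Sum>S\<in>layer_sets U. \<Sum>t\<in>layers n (touched (\<Union>S)). h (S # t))"
  by (auto simp: sum.reindex inj_on_def sum.Sigma finite_layer_sets finite_layers
      case_prod_unfold intro!: sum.cong)

lemma layers_SucE:
  assumes "t \<in> layers (Suc n) U"
  obtains S t' where "t = S # t'" "S \<in> layer_sets U" "t' \<in> layers n (touched (\<Union>S))"
  using assms by auto

lemma length_layers: "t \<in> layers n U \<Longrightarrow> length t = n"
  by (induction n arbitrary: t U) auto

lemma layers_mono: "U \<subseteq> U' \<Longrightarrow> layers n U \<subseteq> layers n U'"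
proof (cases n)
  case (Suc m)
  assume "U \<subseteq> U'"
  then have "layer_sets U \<subseteq> layer_sets U'" unfolding layer_sets_def by blast
  then show ?thesis unfolding Suc layers.simps by blast
qed simp

lemma layers_pad: "t \<in> layers n U \<Longrightarrow> t @ [{}] \<in> layers (Suc n) U"
proof (induction n arbitrary: t U)
  case 0
  then show ?case by (simp add: layer_sets_def stable_def image_iff)
next
  case (Suc n)
  from Suc.prems(1) obtain S t' where
    t: "t = S # t'" "S \<in> layer_sets U" "t' \<in> layers n (touched (\<Union>S))"
    by (rule layers_SucE)
  have "S # t' @ [{}] \<in> layers (Suc (Suc n)) U"
    unfolding layers.simps(2)[of "Suc n"] using t(2) Suc.IH[OF t(3)] by blast
  then show ?case using t(1) by simp
qed

text \<open>If \<open>e\<close> is separate from all layers, it joins the root layer and has to meet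
  \<open>U\<close> itself; otherwise it stops directly behind a layer whose blocks it meets. Both
  keep the normal form.\<close>

lemma layers_push:
  assumes "e \<in> F" "t \<in> layers n U" "touched e \<inter> U \<noteq> {} \<or> \<not> separate e t"
  shows "push e t \<in> layers (Suc n) U"
  using assms(2,3)
proof (induction n arbitrary: t U)
  case 0
  then show ?case using assms(1) by (simp add: layer_sets_def stable_def separate_def image_iff)
next
  case (Suc n)
  from Suc.prems(1) obtain S t' where
    t: "t = S # t'" "S \<in> layer_sets U" "t' \<in> layers n (touched (\<Union>S))"
    by (rule layers_SucE)
  show ?case
  proof (cases "separate e t")
    case True
    then have "insert e S \<in> layer_sets U"
      using t(1,2) Suc.prems(2) assms(1)
      unfolding layer_sets_def stable_def separate_def touched_Union by auto
    moreover have "t' @ [{}] \<in> layers (Suc n) (touched (\<Union>(insert e S)))"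
      using layers_pad[OF t(3)] layers_mono[of "touched (\<Union>S)" "touched (\<Union>(insert e S))" "Suc n"]
        touched_Un[of e "\<Union>S"] by (auto simp del: layers.simps)
    ultimately have "insert e S # t' @ [{}] \<in> layers (Suc (Suc n)) U"
      unfolding layers.simps(2)[of "Suc n"] by blast
    then show ?thesis
      using True t(1) by simp
  next
    case False
    then have "push e t' \<in> layers (Suc n) (touched (\<Union>S))"
      using t by (intro Suc.IH) (auto simp: separate_def)
    then have "S # push e t' \<in> layers (Suc (Suc n)) U"
      unfolding layers.simps(2)[of "Suc n"] using t(2) by blast
    then show ?thesis
      using False t(1) by simp
  qed
qed

lemma separateD: "separate e t \<Longrightarrow> e \<in> F \<Longrightarrow> S \<in> set t \<Longrightarrow> e \<notin> S"
  using touched_nonempty by (fastforce simp: separate_def touched_Union)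

lemma push_not_separate: "e \<in> F \<Longrightarrow> \<not> separate e (push e t)"
  using touched_nonempty by (induction t) (auto simp: separate_def touched_Union)

lemma separate_pad [simp]: "separate e (t @ [{}]) = separate e t"
  by (auto simp: separate_def)

text \<open>The position of \<open>e\<close> can be read off: it is the last layer of the pushed
  heap that shares a block with \<open>e\<close>. Deleting \<open>e\<close> there, and the padding,
  recovers the heap.\<close>

lemma push_inj:
  assumes "e \<in> F" "length t = length t'" "push e t = push e t'"
  shows "t = t'"
  using assms(2,3)
proof (induction t t' rule: list_induct2)
  case (Cons S t S' t')
  have contra: False
    if "separate e (R # s)" "push e r = s @ [{}]" for R s r
    using push_not_separate[OF assms(1), of r] that by (auto simp: separate_def)
  show ?case
  proof (cases "separate e (S # t)"; cases "separate e (S' # t')")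
    assume sep: "separate e (S # t)" "separate e (S' # t')"
    then have "insert e S = insert e S'" "t = t'"
      using Cons.prems by auto
    moreover have "e \<notin> S" "e \<notin> S'"
      using separateD[OF _ assms(1)] sep by auto
    ultimately show ?thesis by (simp add: insert_ident)
  next
    assume "separate e (S # t)" "\<not> separate e (S' # t')"
    then have False using Cons.prems contra[of S t t'] by simp
    then show ?thesis ..
  next
    assume "\<not> separate e (S # t)" "separate e (S' # t')"
    then have False using Cons.prems contra[of S' t' t] by simp
    then show ?thesis ..
  next
    assume "\<not> separate e (S # t)" "\<not> separate e (S' # t')"
    then show ?thesis using Cons.prems Cons.IH by simp
  qed
qed simp

section \<open>Heaps as operators on functions of the row\<close>

lemma replay_nonneg: "(\<And>X. g X \<ge> 0) \<Longrightarrow> replay t g X \<ge> 0"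
  by (induction t arbitrary: g X) (auto simp: step_nonneg)

lemma replay_mono: "(\<And>X. f X \<le> g X) \<Longrightarrow> replay t f X \<le> replay t g X"
  by (induction t arbitrary: f g X) (auto simp: step_mono)

lemma replay_pad [simp]: "replay (t @ [{}]) g = replay t g"
  by (induction t arbitrary: g) auto

lemma step_replay_separate:
  assumes "separate e t"
  shows "step e (replay t g) = replay t (step e g)"
  using assms
proof (induction t arbitrary: g)
  case (Cons S t)
  then have d: "touched e \<inter> touched (\<Union>S) = {}"
    by (simp add: separate_def)
  have "step e (replay (S # t) g) = replay t (step e (step (\<Union>S) g))"
    using Cons by (simp add: separate_def)
  also have "step e (step (\<Union>S) g) = step (\<Union>S) (step e g)"
    using d by (simp add: step_step Un_commute Int_commute)
  finally show ?case by simp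
qed simp

text \<open>Performing \<open>e\<close> first is the far-end position; sliding it towards the root
  only passes layers with which its step commutes.\<close>

lemma replay_push: "replay (push e t) g = step e (replay t g)"
proof (induction t arbitrary: g)
  case (Cons S t)
  show ?case
  proof (cases "separate e (S # t)")
    case True
    then have "separate e t" "touched e \<inter> touched (\<Union>S) = {}"
      by (auto simp: separate_def)
    then show ?thesis
      using True by (simp add: step_replay_separate step_step)
  qed (simp add: Cons.IH)
qed simp

lemma replay_replicate [simp]: "replay (replicate n {}) g = g"
  by (induction n) auto

lemma replicate_layers: "replicate n {} \<in> layers n U"
proof (induction n arbitrary: U)
  case (Suc n)
  have "{} \<in> layer_sets U" by (simp add: layer_sets_def stable_def)
  then show ?case using Suc[of "touched (\<Union>{})"] unfolding layers.simps replicate_Suc by blast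
qed simp

text \<open>The empty heap, encoded as \<open>n\<close> empty layers, contributes
  \<open>g X\<close>, and the other terms are nonnegative.\<close>

lemma potential_ge: "(\<And>X. g X \<ge> 0) \<Longrightarrow> g X \<le> potential n i g X"
  unfolding potential_def
  using member_le_sum[OF replicate_layers, of n "{i}" "\<lambda>t. replay t g X"] finite_layers[of n "{i}"]
  by (simp add: replay_nonneg)

text \<open>Prepending the occurrence of \<open>e\<close> is an injection of heaps, and it turns the weight
  \<open>replay t g\<close> into \<open>step e (replay t g)\<close>; only heaps untouched by \<open>e\<close> need \<open>step e g \<le> g\<close>.\<close>

lemma step_potential:
  assumes e: "e \<in> F" and g: "\<And>X. g X \<ge> 0"
    and le: "\<And>X. i \<notin> touched e \<Longrightarrow> step e g X \<le> g X"
  shows "of_bool (i \<in> touched e) * g X + step e (potential n i g) X \<le> potential (Suc n) i g X"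
proof -
  define hit where "hit t \<longleftrightarrow> touched e \<inter> {i} \<noteq> {} \<or> \<not> separate e t" for t
  define P where "P = {t \<in> layers n {i}. hit t}"
  define Q where "Q = {t \<in> layers n {i}. \<not> hit t}"
  \<comment> \<open>If \<open>e\<close> touches the root block, all heaps are in \<open>P\<close>
    and the empty heap is missed by \<open>push e\<close>; it supplies the extra term
    \<open>g X\<close>.\<close>
  define Z where "Z = (if i \<in> touched e then {replicate (Suc n) {}} else {} :: 'a set set list set)"
  define S where "S = push e ` P \<union> (\<lambda>t. t @ [{}]) ` Q \<union> Z"
  have fin: "finite P" "finite Q" "finite Z"
    by (simp_all add: P_def Q_def Z_def finite_layers)
  have sub: "S \<subseteq> layers (Suc n) {i}"
    using layers_push[OF e] layers_pad replicate_layers[of "Suc n"]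
    by (auto simp: S_def P_def Q_def Z_def hit_def simp del: layers.simps replicate.simps)
  have inj: "inj_on (push e) P" "inj_on (\<lambda>t. t @ [{}]) Q"
    using push_inj[OF e] length_layers by (auto simp: inj_on_def P_def)
  have sepZ: "separate e (replicate (Suc n) {})"
    by (auto simp: separate_def)
  have disj: "push e ` P \<inter> (\<lambda>t. t @ [{}]) ` Q = {}" "(push e ` P \<union> (\<lambda>t. t @ [{}]) ` Q) \<inter> Z = {}"
    using push_not_separate[OF e] sepZ
    by (auto simp: Q_def Z_def hit_def simp del: replicate.simps split: if_splits) (metis separate_pad)+
  have "of_bool (i \<in> touched e) * g X + step e (potential n i g) X
      = (\<Sum>t\<in>Z. replay t g X) + (\<Sum>t\<in>layers n {i}. step e (replay t g) X)"
    by (auto simp: Z_def potential_def[abs_def] step_sum simp del: replicate.simps)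
  also have "(\<Sum>t\<in>layers n {i}. step e (replay t g) X)
      = (\<Sum>t\<in>P. step e (replay t g) X) + (\<Sum>t\<in>Q. step e (replay t g) X)"
    using fin by (subst sum.union_disjoint[symmetric]) (auto simp: P_def Q_def intro: sum.cong)
  also have "(\<Sum>t\<in>Q. step e (replay t g) X) \<le> (\<Sum>t\<in>Q. replay t g X)"
    using le by (intro sum_mono) (auto simp: Q_def hit_def step_replay_separate intro: replay_mono)
  also have "(\<Sum>t\<in>P. step e (replay t g) X) = (\<Sum>t\<in>push e ` P. replay t g X)"
    using inj by (simp add: sum.reindex replay_push)
  also have "(\<Sum>t\<in>Q. replay t g X) = (\<Sum>t\<in>(\<lambda>t. t @ [{}]) ` Q. replay t g X)"
    using inj by (simp add: sum.reindex)
  also have "(\<Sum>t\<in>Z. replay t g X) + ((\<Sum>t\<in>push e ` P. replay t g X)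
      + (\<Sum>t\<in>(\<lambda>t. t @ [{}]) ` Q. replay t g X)) = (\<Sum>t\<in>S. replay t g X)"
    unfolding S_def using fin disj by (simp add: sum.union_disjoint)
  also have "\<dots> \<le> potential (Suc n) i g X"
    unfolding potential_def using sub g by (intro sum_mono2) (auto simp: finite_layers replay_nonneg simp del: layers.simps)
  finally show ?thesis by simp
qed

section \<open>Mean weights of heaps and the bound on their total mass\<close>

lemma avg_step_stable:
  assumes "S \<subseteq> F" "stable S"
  shows "avg {1..k} (step (\<Union>S) g) X = (1 / real b ^ 2) ^ card S * avg {1..k} g X"
proof -
  have "finite S" using assms(1) finite_edges finite_subset by blast
  then show ?thesis using assms
  proof (induction S)
    case (insert e S)
    have "touched e \<inter> touched (\<Union>S) = {}"
      using insert by (auto simp: stable_def touched_Union)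
    then have "avg {1..k} (step (\<Union>(insert e S)) g) X = avg {1..k} (step e (step (\<Union>S) g)) X"
      by (simp add: step_step)
    also have "\<dots> = 1 / real b ^ 2 * avg {1..k} (step (\<Union>S) g) X"
      unfolding avg_all_step using insert.prems card_block_edge card_touched
      by (simp add: power_divide)
    finally show ?case
      using insert by (simp add: stable_def)
  qed simp
qed

text \<open>Under a uniform row each layer only multiplies the average by a constant, so the factor
  of a heap depends on its size alone and not on \<open>g\<close>.\<close>

lemma avg_potential: "avg {1..k} (potential n i g) X = mass n {i} * avg {1..k} g X"
proof -
  have "avg {1..k} (replay t g) X = (1 / real b ^ 2) ^ heap_size t * avg {1..k} g X"
    if "t \<in> layers n U" for t U
    using that
  proof (induction n arbitrary: t U g)
    case (Suc n)
    from Suc.prems obtain S t' where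
      t: "t = S # t'" "S \<in> layer_sets U" "t' \<in> layers n (touched (\<Union>S))"
      by (rule layers_SucE)
    then show ?case
      using Suc.IH[OF t(3)] layer_setsD[OF t(2)]
      by (simp add: heap_size_def avg_step_stable power_add del: One_nat_def)
  qed (simp add: heap_size_def)
  then show ?thesis
    by (simp add: potential_def[abs_def] avg_sum mass_def sum_distrib_right del: One_nat_def)
qed

lemma mass_Suc:
  "mass (Suc n) U = (\<Sum>S\<in>layer_sets U. (1 / real b ^ 2) ^ card S * mass n (touched (\<Union>S)))"
  by (simp add: mass_def sum_layers_Suc heap_size_def power_add sum_distrib_left del: layers.simps)

text \<open>Expanding the product selects for each block of \<open>U\<close> either nothing or one
  edge touching it. Every layer arises from such a selection; surplus selections only add
  nonnegative terms.\<close>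

lemma sum_layer_sets_le:
  fixes w :: "'a set \<Rightarrow> real"
  assumes w: "\<And>f. w f \<ge> 0" and "finite U"
  shows "(\<Sum>S\<in>layer_sets U. \<Prod>f\<in>S. w f) \<le> (\<Prod>i\<in>U. 1 + (\<Sum>f | f \<in> F \<and> i \<in> touched f. w f))"
  using \<open>finite U\<close>
proof (induction U)
  case empty
  have "layer_sets {} = {{}}" by (auto simp: layer_sets_def stable_def)
  then show ?case by simp
next
  case (insert i U)
  define Fi where "Fi = {f \<in> F. i \<in> touched f}"
  define v where "v a = (case a of None \<Rightarrow> 1 | Some f \<Rightarrow> w f)" for a
  define add where "add = (\<lambda>(a, S). case a of None \<Rightarrow> S | Some f \<Rightarrow> (insert f S :: 'a set set))"
  define T where "T = insert None (Some ` Fi) \<times> layer_sets U"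
  have finFi: "finite Fi" by (simp add: Fi_def finite_edges)
  have "(\<Sum>S\<in>layer_sets (insert i U). \<Prod>f\<in>S. w f) \<le> (\<Sum>(a, S)\<in>T. v a * (\<Prod>f\<in>S. w f))"
  proof (rule sum_le_included[where i = add])
    show "finite T" "finite (layer_sets (insert i U))"
      by (simp_all add: T_def finFi finite_layer_sets)
    show "\<forall>y\<in>T. 0 \<le> (case y of (a, S) \<Rightarrow> v a * (\<Prod>f\<in>S. w f))"
      using w by (auto simp: v_def intro!: mult_nonneg_nonneg prod_nonneg split: option.splits)
    show "\<forall>S\<in>layer_sets (insert i U). \<exists>y\<in>T. add y = S \<and>
        (\<Prod>f\<in>S. w f) \<le> (case y of (a, S) \<Rightarrow> v a * (\<Prod>f\<in>S. w f))"
    proof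
      fix S assume S: "S \<in> layer_sets (insert i U)"
      have "finite S" using layer_setsD(1)[OF S] finite_edges finite_subset by blast
      show "\<exists>y\<in>T. add y = S \<and> (\<Prod>f\<in>S. w f) \<le> (case y of (a, S) \<Rightarrow> v a * (\<Prod>f\<in>S. w f))"
      proof (cases "\<exists>f\<in>S. i \<in> touched f")
        case True
        then obtain f where f: "f \<in> S" "i \<in> touched f" by blast
        have "stable S" using S by (simp add: layer_sets_def)
        have "touched g \<inter> U \<noteq> {}" if "g \<in> S - {f}" for g
        proof -
          have "touched g \<inter> touched f = {}"
            using \<open>stable S\<close> that f(1) by (simp add: stable_def)
          moreover have "touched g \<inter> insert i U \<noteq> {}"
            using S that by (simp add: layer_sets_def)
          ultimately show ?thesis using f(2) by auto
        qed
        then have "S - {f} \<in> layer_sets U"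
          using layer_setsD(1)[OF S] \<open>stable S\<close> by (auto simp: layer_sets_def stable_def)
        moreover have "f \<in> Fi" using f layer_setsD(1)[OF S] by (auto simp: Fi_def)
        moreover have "(\<Prod>f\<in>S. w f) = w f * (\<Prod>f\<in>S - {f}. w f)"
          using \<open>finite S\<close> f(1) by (simp add: prod.remove)
        ultimately show ?thesis
          using f by (intro bexI[of _ "(Some f, S - {f})"]) (auto simp: T_def add_def v_def)
      next
        case False
        then have "S \<in> layer_sets U"
          using S by (auto simp: layer_sets_def)
        then show ?thesis
          by (intro bexI[of _ "(None, S)"]) (auto simp: T_def add_def v_def)
      qed
    qed
  qed
  also have "\<dots> = (\<Sum>a\<in>insert None (Some ` Fi). v a) * (\<Sum>S\<in>layer_sets U. \<Prod>f\<in>S. w f)"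
    by (simp add: T_def sum_product sum.cartesian_product)
  also have "(\<Sum>a\<in>insert None (Some ` Fi). v a) = 1 + (\<Sum>f\<in>Fi. w f)"
    using finFi by (simp add: v_def sum.reindex image_iff)
  also have "(1 + (\<Sum>f\<in>Fi. w f)) * (\<Sum>S\<in>layer_sets U. \<Prod>f\<in>S. w f)
      \<le> (1 + (\<Sum>f\<in>Fi. w f)) * (\<Prod>i\<in>U. 1 + (\<Sum>f | f \<in> F \<and> i \<in> touched f. w f))"
    using w by (intro mult_left_mono insert.IH) (simp add: sum_nonneg)
  finally show ?case
    using insert.hyps by (simp add: Fi_def)
qed

text \<open>The masses obey a recursion in the height, and \<open>rec\<close> makes \<open>z\<close>
  a supersolution of it. Since \<open>z\<close> also dominates height 0, the bound is uniform in
  \<open>n\<close>.\<close>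

lemma mass_le:
  assumes z: "\<And>i. z i \<ge> 1" and U: "U \<subseteq> {1..k}"
    and rec: "\<And>i. i \<in> {1..k} \<Longrightarrow>
      1 + (\<Sum>f | f \<in> F \<and> i \<in> touched f. 1 / real b ^ 2 * (\<Prod>j\<in>touched f. z j)) \<le> z i"
  shows "mass n U \<le> (\<Prod>i\<in>U. z i)"
  using U
proof (induction n arbitrary: U)
  case 0
  then show ?case using z by (auto simp: mass_def heap_size_def intro!: prod_ge_1)
next
  case (Suc n)
  define w where "w f = 1 / real b ^ 2 * (\<Prod>j\<in>touched f. z j)" for f
  have z0: "z i \<ge> 0" for i using z[of i] by linarith
  have w: "w f \<ge> 0" for f
    unfolding w_def by (intro mult_nonneg_nonneg prod_nonneg) (use z0 in auto)
  have "finite U" using Suc.prems finite_subset by blast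
  have "mass (Suc n) U \<le> (\<Sum>S\<in>layer_sets U. (1 / real b ^ 2) ^ card S * (\<Prod>i\<in>touched (\<Union>S). z i))"
    unfolding mass_Suc by (intro sum_mono mult_left_mono Suc.IH touched_subset) auto
  also have "\<dots> = (\<Sum>S\<in>layer_sets U. \<Prod>f\<in>S. w f)"
  proof (intro sum.cong refl)
    fix S assume S: "S \<in> layer_sets U"
    then have "finite S" using layer_setsD(1) finite_edges finite_subset by blast
    then have "(\<Prod>i\<in>touched (\<Union>S). z i) = (\<Prod>f\<in>S. \<Prod>i\<in>touched f. z i)"
      unfolding touched_Union using layer_setsD(2)[OF S]
      by (intro prod.UNION_disjoint) (auto simp: stable_def)
    then show "(1 / real b ^ 2) ^ card S * (\<Prod>i\<in>touched (\<Union>S). z i) = (\<Prod>f\<in>S. w f)"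
      by (simp add: w_def prod.distrib prod_dividef power_one_over field_simps)
  qed
  also have "\<dots> \<le> (\<Prod>i\<in>U. 1 + (\<Sum>f | f \<in> F \<and> i \<in> touched f. w f))"
    by (intro sum_layer_sets_le w \<open>finite U\<close>)
  also have "\<dots> \<le> (\<Prod>i\<in>U. z i)"
    using rec Suc.prems w by (intro prod_mono) (auto simp: w_def sum_nonneg)
  finally show ?case .
qed

end

subsection \<open>The Moser--Tardos process\<close>

lemma measure_measure_spmf_bind_pmf:
  "measure (measure_spmf (bind_pmf p f)) A
    = measure_pmf.expectation p (\<lambda>x. measure (measure_spmf (f x)) A)"
  by (simp add: measure_spmf_bind_pmf measure_pmf.measure_bind[where N = "count_space UNIV"])

locale moser_tardos = blocks +
  fixes E :: "'a set set" and R :: "'a rule"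
  assumes finite_E: "finite E"
    and card_edge: "\<And>e. e \<in> E \<Longrightarrow> card e = 2"
    and rule: "selection_rule E k R"
begin

definition valid :: "(nat \<Rightarrow> 'a) \<Rightarrow> bool" where
  "valid X \<longleftrightarrow> (\<forall>i\<in>{1..k}. X i \<in> B i)"

text \<open>The edges that can become bad while \<open>T\<close> avoids \<open>L\<close>; an edge
  inside one block never can, as only one vertex per block is chosen. The heaps use \<open>L\<close>
  itself for the hitting bound and \<open>{}\<close> for termination.\<close>

definition cross_edges :: "'a set \<Rightarrow> 'a set set" where
  "cross_edges L = {e \<in> E. e \<inter> L = {} \<and> card (touched e) = 2 \<and> (\<forall>i\<in>touched e. card (B i \<inter> e) = 1)}"

sublocale avoiding: conflict_edges B k b "cross_edges L" for L
  using finite_E by unfold_locales (auto simp: cross_edges_def)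

text \<open>Blocks are disjoint, so a chosen vertex lies in no block but its own. The endpoints of a
  bad edge therefore come from two different blocks, which are exactly the touched ones.\<close>

lemma bad_edge:
  assumes X: "valid X" and e: "e \<in> bad_edges E k X"
  shows "covers e X" "e \<inter> L = {} \<Longrightarrow> e \<in> cross_edges L" "e \<subseteq> X ` touched e"
    "touched e \<noteq> {}"
proof -
  have "e \<in> E" "e \<subseteq> X ` {1..k}"
    using e by (auto simp: bad_edges_def chosen_def)
  obtain u w where uw: "e = {u, w}" "u \<noteq> w"
    using card_edge[OF \<open>e \<in> E\<close>] by (auto simp: card_2_iff)
  then obtain i j where ij: "i \<in> {1..k}" "j \<in> {1..k}" "u = X i" "w = X j"
    using \<open>e \<subseteq> X ` {1..k}\<close> by auto
  have "i \<noteq> j" using uw ij by auto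
  have own: "l = m" if "l \<in> {1..k}" "m \<in> {1..k}" "X l \<in> B m" for l m
    using that X disjoint_blocks unfolding valid_def disjoint_family_on_def by blast
  have XB: "X l \<in> B l" if "l \<in> {1..k}" for l
    using X that by (simp add: valid_def)
  have t: "touched e = {i, j}"
    using own ij uw XB by (auto simp: touched_def)
  have Be: "B i \<inter> e = {u}" "B j \<inter> e = {w}"
    using own ij uw XB \<open>i \<noteq> j\<close> by auto
  show "covers e X" "e \<subseteq> X ` touched e" "touched e \<noteq> {}"
    using t ij uw XB by (auto simp: covers_def)
  show "e \<inter> L = {} \<Longrightarrow> e \<in> cross_edges L"
    using t Be \<open>e \<in> E\<close> \<open>i \<noteq> j\<close> by (auto simp: cross_edges_def)
qed

lemma mt_resample_block_pmf:
  "mt_resample B k e X = map_pmf (\<lambda>Y. override_on X Y (touched e)) (block_pmf (touched e))"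
  by (simp add: mt_resample_def touched_def block_pmf_def Let_def)

lemma finite_mt_resample: "finite (set_pmf (mt_resample B k e X))"
  by (simp add: mt_resample_block_pmf finite_block_pmf[OF touched_subset])

text \<open>A bad edge passes the test in \<open>step\<close>, which leaves exactly the average over
  fresh values.\<close>

lemma expectation_mt_resample:
  assumes "valid X" "e \<in> bad_edges E k X"
  shows "measure_pmf.expectation (mt_resample B k e X) g = step e g X"
  using bad_edge(1)[OF assms] by (simp add: mt_resample_block_pmf avg_def step_def)

lemma valid_mt_resample:
  assumes "valid X" "X' \<in> set_pmf (mt_resample B k e X)"
  shows "valid X'"
  unfolding valid_def
proof
  fix i assume "i \<in> {1..k}"
  then have "X i \<in> B i" using assms(1) by (simp add: valid_def)
  then show "X' i \<in> B i"
    using assms(2) by (cases "i \<in> touched e")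
      (auto simp: mt_resample_block_pmf set_block_pmf[OF touched_subset] PiE_dflt_def)
qed

lemma finite_bad_edges: "finite (bad_edges E k X)"
  using finite_E by (simp add: bad_edges_def)

lemma finite_rule: "bad_edges E k X \<noteq> {} \<Longrightarrow> finite (set_pmf (R h X))"
  using rule finite_bad_edges by (meson finite_subset selection_rule_def)

text \<open>Mean over one iteration of the loop. The integrand may depend on the selected edge
  because that edge enters the history.\<close>

definition round_avg :: "'a history \<Rightarrow> (nat \<Rightarrow> 'a) \<Rightarrow> ('a set \<Rightarrow> (nat \<Rightarrow> 'a) \<Rightarrow> real) \<Rightarrow> real" where
  "round_avg h X g = measure_pmf.expectation (R h X)
     (\<lambda>e. measure_pmf.expectation (mt_resample B k e X) (g e))"

lemma round_avg_mono:
  assumes "valid X" "bad_edges E k X \<noteq> {}"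
    and "\<And>e X'. e \<in> bad_edges E k X \<Longrightarrow> valid X' \<Longrightarrow> f e X' \<le> g e X'"
  shows "round_avg h X f \<le> round_avg h X g"
  unfolding round_avg_def
proof (intro expectation_mono_finite finite_rule finite_mt_resample assms)
  show "e \<in> bad_edges E k X" if "e \<in> set_pmf (R h X)" for e
    using that rule assms(2) by (auto simp: selection_rule_def)
  show "valid X'" if "X' \<in> set_pmf (mt_resample B k e X)" for e X'
    using that assms(1) valid_mt_resample by blast
qed

text \<open>An estimate for every bad edge holds for every randomized choice among them: this makes
  the result independent of the rule.\<close>

lemma round_avg_le:
  assumes "valid X" "bad_edges E k X \<noteq> {}"
    and "\<And>e. e \<in> bad_edges E k X \<Longrightarrow> step e g X \<le> c"
  shows "round_avg h X (\<lambda>_. g) \<le> c"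
proof -
  have "e \<in> bad_edges E k X" if "e \<in> set_pmf (R h X)" for e
    using that rule assms(2) by (auto simp: selection_rule_def)
  then have "round_avg h X (\<lambda>_. g) \<le> measure_pmf.expectation (R h X) (\<lambda>_. c)"
    unfolding round_avg_def using assms
    by (intro expectation_mono_finite finite_rule) (auto simp: expectation_mt_resample)
  then show ?thesis by simp
qed

lemma round_avg_add:
  assumes "bad_edges E k X \<noteq> {}"
  shows "round_avg h X (\<lambda>e X'. f e X' + g e X') = round_avg h X f + round_avg h X g"
  using finite_rule[OF assms]
  by (simp add: round_avg_def integrable_measure_pmf_finite finite_mt_resample)

lemma round_avg_const [simp]: "round_avg h X (\<lambda>_ _. c) = c"
  by (simp add: round_avg_def)

lemma round_avg_cmult: "round_avg h X (\<lambda>e X'. c * f e X') = c * round_avg h X f"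
  by (simp add: round_avg_def)

section \<open>Termination of the loop\<close>

text \<open>The probability that at least \<open>n\<close> resamplings are performed.\<close>

fun survival :: "nat \<Rightarrow> 'a history \<Rightarrow> (nat \<Rightarrow> 'a) \<Rightarrow> real" where
  "survival 0 h X = 1"
| "survival (Suc n) h X = (if bad_edges E k X = {} then 0
     else round_avg h X (\<lambda>e. survival n (h @ [(X, e)])))"

lemma measure_mt_loop:
  "measure (measure_spmf (mt_loop E B k R h X)) A =
    (if bad_edges E k X = {} then indicator A X
     else round_avg h X (\<lambda>e X'. measure (measure_spmf (mt_loop E B k R (h @ [(X, e)]) X')) A))"
  by (subst mt_loop.simps)
    (simp add: measure_measure_spmf_bind_pmf round_avg_def measure_spmf_return_spmf measure_return)

lemma survival_nonneg: "0 \<le> survival n h X"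
  by (induction n arbitrary: h X) (auto simp: round_avg_def intro!: Bochner_Integration.integral_nonneg)

lemma survival_le_1: "valid X \<Longrightarrow> survival n h X \<le> 1"
proof (induction n arbitrary: h X)
  case (Suc n)
  have "round_avg h X (\<lambda>e. survival n (h @ [(X, e)])) \<le> round_avg h X (\<lambda>_ _. 1)"
    if "bad_edges E k X \<noteq> {}"
    using Suc that by (intro round_avg_mono) auto
  then show ?case by simp
qed simp

text \<open>A run either performs \<open>n\<close> resamplings or stops before that, and in the
  latter case it contributes to the weight.\<close>

lemma one_minus_survival_le_weight:
  "valid X \<Longrightarrow> 1 - survival n h X \<le> weight_spmf (mt_loop E B k R h X)"
proof (induction n arbitrary: h X)
  case 0
  then show ?case by (simp add: weight_spmf_nonneg)
next
  case (Suc n)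
  show ?case
  proof (cases "bad_edges E k X = {}")
    case False
    have "1 = round_avg h X (\<lambda>_ _. 1)" by simp
    also have "\<dots> \<le> round_avg h X (\<lambda>e X'. weight_spmf (mt_loop E B k R (h @ [(X, e)]) X')
        + survival n (h @ [(X, e)]) X')"
    proof (intro round_avg_mono Suc.prems False)
      fix e X' assume "valid X'"
      then show "1 \<le> weight_spmf (mt_loop E B k R (h @ [(X, e)]) X') + survival n (h @ [(X, e)]) X'"
        using Suc.IH[of X' "h @ [(X, e)]"] by simp
    qed
    finally show ?thesis
      using False by (simp add: round_avg_add weight_spmf_def measure_mt_loop[of h X])
  qed (simp add: weight_spmf_def measure_mt_loop[of h X])
qed

text \<open>The potential with root \<open>i\<close> and \<open>g = 1\<close> exceeds by at least one the expected number of
  resamplings of block \<open>i\<close>.\<close>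

lemma survival_le_potential:
  "valid X \<Longrightarrow> real n * survival n h X
    \<le> (\<Sum>i\<in>{1..k}. avoiding.potential {} n i (\<lambda>_. 1) X - 1)"
proof (induction n arbitrary: h X)
  case 0
  then show ?case
    by (auto intro!: sum_nonneg avoiding.potential_ge[of "\<lambda>_. 1"])
next
  case (Suc n)
  define H where "H n X = (\<Sum>i\<in>{1..k}. avoiding.potential {} n i (\<lambda>_. 1) X - 1)" for n X
  show ?case
  proof (cases "bad_edges E k X = {}")
    case True
    then show ?thesis
      using avoiding.potential_ge[of "\<lambda>_. 1"] by (auto intro!: sum_nonneg)
  next
    case False
    have "real (Suc n) * survival (Suc n) h X
        = round_avg h X (\<lambda>e X'. real (Suc n) * survival n (h @ [(X, e)]) X')"
      using False by (simp add: round_avg_cmult del: of_nat_Suc)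
    also have "\<dots> \<le> round_avg h X (\<lambda>e X'. 1 + H n X')"
    proof (intro round_avg_mono Suc.prems False)
      fix e X' assume X': "valid X'"
      show "real (Suc n) * survival n (h @ [(X, e)]) X' \<le> 1 + H n X'"
        using Suc.IH[OF X', of "h @ [(X, e)]"] survival_le_1[OF X', of n "h @ [(X, e)]"]
        by (simp add: H_def algebra_simps)
    qed
    also have "\<dots> \<le> H (Suc n) X"
    proof (intro round_avg_le Suc.prems False)
      fix e assume e: "e \<in> bad_edges E k X"
      note b = bad_edge[OF Suc.prems e]
      have step1: "step e (\<lambda>_. 1) Y \<le> 1" for Y
        by (simp add: step_def)
      have "step e (\<lambda>_. c) X = c" for c
        using b(1) by (simp add: step_def)
      define Q where "Q = (\<Sum>i\<in>{1..k}. step e (avoiding.potential {} n i (\<lambda>_. 1)) X - 1)"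
      have "step e (\<lambda>X'. 1 + H n X') X = 1 + Q"
        using b(1) by (simp add: step_def H_def Q_def avg_add[OF touched_subset] avg_sum[OF touched_subset]
            sum_subtractf diff_conv_add_uminus del: add_uminus_conv_diff One_nat_def)
      \<comment> \<open>A bad edge touches some block, and \<open>step_potential\<close> gains one
        for each touched block; this pays for the current resampling.\<close>
      moreover have "1 \<le> real (card (touched e))"
        using b(4) by (simp add: Suc_leI card_gt_0_iff)
      moreover have "real (card (touched e)) = (\<Sum>i\<in>{1..k}. of_bool (i \<in> touched e))"
        using touched_subset[of e] by (simp add: sum.inter_restrict[symmetric] of_bool_def Int_absorb1 del: One_nat_def)
      moreover have "(\<Sum>i\<in>{1..k}. of_bool (i \<in> touched e)) + Q
          = (\<Sum>i\<in>{1..k}. of_bool (i \<in> touched e) * 1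
              + step e (avoiding.potential {} n i (\<lambda>_. 1)) X - 1)"
        unfolding Q_def by (subst sum.distrib[symmetric]) (intro sum.cong refl, simp)
      moreover have "\<dots> \<le> H (Suc n) X"
        unfolding H_def
        by (intro sum_mono diff_right_mono avoiding.step_potential) (use b(2) step1 in auto)
      ultimately show "step e (\<lambda>X'. 1 + H n X') X \<le> H (Suc n) X" by linarith
    qed
    finally show ?thesis by (simp add: H_def)
  qed
qed

section \<open>The probability of meeting \<open>L\<close>\<close>

text \<open>Written as one constraint per block, so that its average factorises over the
  blocks.\<close>

definition first_hit :: "'a set \<Rightarrow> nat \<Rightarrow> (nat \<Rightarrow> 'a) \<Rightarrow> real" where
  "first_hit L i X = of_bool (\<forall>j\<in>{1..k}. X j \<in> (if j < i then - L else if j = i then L else UNIV))"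

lemma sum_first_hit:
  assumes "\<exists>i\<in>{1..k}. X i \<in> L"
  shows "1 \<le> (\<Sum>i\<in>{1..k}. first_hit L i X)"
proof -
  define i where "i = (LEAST i. i \<in> {1..k} \<and> X i \<in> L)"
  have i: "i \<in> {1..k} \<and> X i \<in> L"
    unfolding i_def by (rule LeastI_ex) (use assms in blast)
  have "X j \<notin> L" if "j \<in> {1..k}" "j < i" for j
    using not_less_Least[of j "\<lambda>i. i \<in> {1..k} \<and> X i \<in> L"] that by (simp add: i_def)
  then have "first_hit L i X = 1"
    using i by (simp add: first_hit_def)
  then show ?thesis
    using member_le_sum[of i "{1..k}" "\<lambda>i. first_hit L i X"] i by (simp add: first_hit_def)
qed

text \<open>Resampling an edge outside \<open>L\<close> does not touch the constraints violated by \<open>first_hit\<close>,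
  so blocks before \<open>i\<close> keep their factor of avoiding \<open>L\<close>.\<close>

lemma step_first_hit:
  assumes "e \<inter> L = {}" "i \<notin> touched e"
  shows "step e (first_hit L i) X \<le> first_hit L i X"
proof (cases "covers e X \<and> first_hit L i X = 0")
  case True
  then obtain j where j: "j \<in> {1..k}" "X j \<notin> (if j < i then - L else if j = i then L else UNIV)"
    by (auto simp: first_hit_def split: if_splits)
  \<comment> \<open>At \<open>j < i\<close> the violating vertex \<open>X j\<close> lies in
    \<open>L\<close>, while a touched block shows a vertex of \<open>e\<close>; at
    \<open>j = i\<close> the block is untouched by assumption.\<close>
  then have "j \<notin> touched e"
    using True assms by (auto simp: covers_def split: if_splits)
  then have "override_on X Y (touched e) j \<notin> (if j < i then - L else if j = i then L else UNIV)"
    for Y :: "nat \<Rightarrow> 'a"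
    using j(2) by (simp only: override_on_apply_notin not_False_eq_True)
  then have "first_hit L i (override_on X Y (touched e)) = 0" for Y
    unfolding first_hit_def of_bool_eq_0_iff using j(1) by blast
  then show ?thesis
    using True by (simp add: step_def avg_def)
next
  case False
  have "avg (touched e) (first_hit L i) X \<le> avg (touched e) (\<lambda>_. 1) X"
    by (intro avg_mono touched_subset) (simp add: first_hit_def)
  then show ?thesis
    using False by (auto simp: step_def first_hit_def)
qed

text \<open>Once \<open>X\<close> meets \<open>L\<close>, the \<open>first_hit\<close> indicators
  sum to at least one and the bound is trivial. Before that every bad edge avoids \<open>L\<close>,
  so the potential cannot grow on average. Runs still going after \<open>n\<close> rounds are
  charged to \<open>survival\<close>.\<close>

lemma measure_hit_le:
  "valid X \<Longrightarrow> measure (measure_spmf (mt_loop E B k R h X)) {Y. \<exists>i\<in>{1..k}. Y i \<in> L}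
    \<le> (\<Sum>i\<in>{1..k}. avoiding.potential L n i (first_hit L i) X) + survival n h X"
proof (induction n arbitrary: h X)
  case 0
  have "0 \<le> (\<Sum>i\<in>{1..k}. avoiding.potential L 0 i (first_hit L i) X)"
    by (intro sum_nonneg order_trans[OF _ avoiding.potential_ge]) (simp_all add: first_hit_def)
  then show ?case
    using measure_spmf.subprob_measure_le_1[of "mt_loop E B k R h X" "{Y. \<exists>i\<in>{1..k}. Y i \<in> L}"]
    by simp
next
  case (Suc n)
  define H where "H n X = (\<Sum>i\<in>{1..k}. avoiding.potential L n i (first_hit L i) X)" for n X
  define M where "M h X = measure (measure_spmf (mt_loop E B k R h X)) {Y. \<exists>i\<in>{1..k}. Y i \<in> L}" for h X
  have H_ge: "(\<Sum>i\<in>{1..k}. first_hit L i X) \<le> H n X" for n X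
    unfolding H_def by (intro sum_mono avoiding.potential_ge) (simp add: first_hit_def)
  have H_nonneg: "0 \<le> H n X" for n X
    by (rule order_trans[OF _ H_ge]) (simp add: sum_nonneg first_hit_def)
  have "M h X \<le> H (Suc n) X + survival (Suc n) h X"
  proof (cases "\<exists>i\<in>{1..k}. X i \<in> L")
    case True
    then have "1 \<le> H (Suc n) X"
      using sum_first_hit H_ge order_trans by blast
    then show ?thesis
      using measure_spmf.subprob_measure_le_1[of "mt_loop E B k R h X" "{Y. \<exists>i\<in>{1..k}. Y i \<in> L}"]
        survival_nonneg[of "Suc n" h X] unfolding M_def by linarith
  next
    case False
    show ?thesis
    proof (cases "bad_edges E k X = {}")
      case True
      then show ?thesis
        using False H_nonneg[of "Suc n" X] by (simp add: M_def measure_mt_loop[of h X])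
    next
      case bad: False
      have "M h X = round_avg h X (\<lambda>e. M (h @ [(X, e)]))"
        using bad by (simp add: M_def[abs_def] measure_mt_loop[of h X])
      also have "\<dots> \<le> round_avg h X (\<lambda>e X'. H n X' + survival n (h @ [(X, e)]) X')"
        using Suc by (intro round_avg_mono bad) (auto simp: M_def H_def)
      also have "\<dots> = round_avg h X (\<lambda>e. H n) + survival (Suc n) h X"
        using bad by (simp add: round_avg_add)
      also have "round_avg h X (\<lambda>e. H n) \<le> H (Suc n) X"
      proof (intro round_avg_le Suc.prems bad)
        fix e assume e: "e \<in> bad_edges E k X"
        note be = bad_edge[OF Suc.prems e]
        have eL: "e \<inter> L = {}"
          using be(3) False touched_subset[of e] by blast
        have "step e (H n) X = (\<Sum>i\<in>{1..k}. step e (avoiding.potential L n i (first_hit L i)) X)"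
          unfolding H_def[abs_def] by (rule step_sum)
        also have "\<dots> \<le> (\<Sum>i\<in>{1..k}. of_bool (i \<in> touched e) * first_hit L i X
            + step e (avoiding.potential L n i (first_hit L i)) X)"
          by (intro sum_mono) (simp add: first_hit_def)
        also have "\<dots> \<le> H (Suc n) X"
          unfolding H_def
          by (intro sum_mono avoiding.step_potential step_first_hit be(2) eL) (simp_all add: first_hit_def)
        finally show "step e (H n) X \<le> H (Suc n) X" .
      qed
      finally show ?thesis by simp
    qed
  qed
  then show ?case by (simp only: M_def H_def)
qed

section \<open>Averaging over the initial configuration\<close>

lemma mt_init_block_pmf: "mt_init B k = block_pmf {1..k}"
  by (simp add: mt_init_def block_pmf_def)

lemma expectation_mt_init:
  "measure_pmf.expectation (mt_init B k) g = avg {1..k} g (\<lambda>_. undefined)"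
proof -
  have "override_on (\<lambda>_. undefined) Y {1..k} = Y" if "Y \<in> set_pmf (block_pmf {1..k})" for Y
    using that by (auto simp: set_block_pmf PiE_dflt_def override_on_def)
  then show ?thesis
    unfolding mt_init_block_pmf avg_def by (intro integral_cong_AE) (auto simp: AE_measure_pmf_iff)
qed

lemma valid_mt_init: "X \<in> set_pmf (mt_init B k) \<Longrightarrow> valid X"
  unfolding mt_init_block_pmf by (auto simp: set_block_pmf PiE_dflt_def valid_def)

lemma avg_first_hit:
  assumes "i \<in> {1..k}"
  shows "avg {1..k} (first_hit L i) X
    = real (card (B i \<inter> L)) / real b * (\<Prod>j\<in>{1..<i}. 1 - real (card (B j \<inter> L)) / real b)"
proof -
  define D where "D j = (if j < i then - L else if j = i then L else UNIV)" for j
  define q where "q j = real (card (B j \<inter> D j)) / real b" for j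
  have "avg {1..k} (first_hit L i) X = (\<Prod>j\<in>{1..k}. q j)"
    unfolding first_hit_def[abs_def] D_def[symmetric] q_def by (rule avg_indicator) simp
  also have "\<dots> = (\<Prod>j\<in>insert i ({1..<i} \<union> {i<..k}). q j)"
    using assms by (intro prod.cong) auto
  also have "\<dots> = q i * ((\<Prod>j\<in>{1..<i}. q j) * (\<Prod>j\<in>{i<..k}. q j))"
    by (subst prod.insert) (auto simp: prod.union_disjoint[symmetric] intro!: prod.union_disjoint)
  also have "(\<Prod>j\<in>{i<..k}. q j) = 1"
    using card_block b_pos assms by (intro prod.neutral) (auto simp: q_def D_def)
  also have "(\<Prod>j\<in>{1..<i}. q j) = (\<Prod>j\<in>{1..<i}. 1 - real (card (B j \<inter> L)) / real b)"
  proof (intro prod.cong refl)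
    fix j assume j: "j \<in> {1..<i}"
    then have jk: "j \<in> {1..k}" using assms by auto
    have "card (B j \<inter> - L) + card (B j \<inter> L) = b"
      using finite_block[OF jk] card_block[OF jk]
      by (subst card_Un_disjoint[symmetric]) (auto intro!: arg_cong[where f = card] simp: Int_Un_distrib[symmetric])
    then have "real (card (B j \<inter> - L)) = real b - real (card (B j \<inter> L))" by linarith
    then show "q j = 1 - real (card (B j \<inter> L)) / real b"
      using j b_pos by (simp add: q_def D_def diff_divide_distrib)
  qed
  finally show ?thesis by (simp add: q_def D_def)
qed

text \<open>Averaging over the initial row turns potentials into masses, which are bounded uniformly
  in \<open>n\<close>. So the mean of \<open>survival\<close> is \<open>O(1 / n)\<close>; letting
  \<open>n\<close> tend to infinity gives termination and removes the error term of the hitting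
  bound.\<close>

lemma mt_transversal_bounds:
  assumes z: "\<And>n i. i \<in> {1..k} \<Longrightarrow> avoiding.mass L n {i} \<le> z i"
    and y: "\<And>n i. i \<in> {1..k} \<Longrightarrow> avoiding.mass {} n {i} \<le> y"
  shows "lossless_spmf (mt_transversal E B k R)"
    and "measure (measure_spmf (mt_transversal E B k R)) {T. L \<inter> T \<noteq> {}}
      \<le> (\<Sum>i\<in>{1..k}. real (card (B i \<inter> L)) / real b * z i
            * (\<Prod>j\<in>{1..<i}. 1 - real (card (B j \<inter> L)) / real b))"
proof -
  define p where "p = mt_init B k"
  define s where "s n = measure_pmf.expectation p (survival n [])" for n
  define C where "C = real k * (y - 1)"
  have fin: "finite (set_pmf p)"
    unfolding p_def mt_init_block_pmf by (rule finite_block_pmf) simp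
  have "real n * s n \<le> C" for n
  proof -
    have "real n * s n = measure_pmf.expectation p (\<lambda>X. real n * survival n [] X)"
      by (simp add: s_def)
    also have "\<dots> \<le> measure_pmf.expectation p
        (\<lambda>X. \<Sum>i\<in>{1..k}. avoiding.potential {} n i (\<lambda>_. 1) X + (- 1))"
      using survival_le_potential valid_mt_init
      by (intro expectation_mono_finite fin) (simp add: p_def)
    also have "\<dots> = (\<Sum>i\<in>{1..k}. avoiding.mass {} n {i} + (- 1))"
      unfolding p_def expectation_mt_init
      by (subst avg_sum, simp, subst avg_add, simp, subst avoiding.avg_potential, simp)
    also have "\<dots> \<le> (\<Sum>i\<in>{1..k}. y + (- 1))"
      by (intro sum_mono add_right_mono y)
    finally show ?thesis by (simp add: C_def algebra_simps)
  qed
  then have s_le: "s n \<le> C / real n" if "n > 0" for n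
    using that by (simp add: field_simps)
  have lim: "(\<lambda>n. C / real n) \<longlonglongrightarrow> 0"
    by (rule lim_const_over_n)
  have tr: "measure (measure_spmf (mt_transversal E B k R)) A
      = measure_pmf.expectation p (\<lambda>X. measure (measure_spmf (mt_loop E B k R [] X)) (chosen k -` A))" for A
    by (simp add: mt_transversal_def p_def measure_map_spmf measure_measure_spmf_bind_pmf)
  have "1 - weight_spmf (mt_transversal E B k R) \<le> C / real n" if "n > 0" for n
  proof -
    have "1 - s n = measure_pmf.expectation p (\<lambda>X. 1 - survival n [] X)"
      by (simp add: s_def integrable_measure_pmf_finite fin)
    also have "\<dots> \<le> weight_spmf (mt_transversal E B k R)"
      unfolding weight_spmf_def tr using one_minus_survival_le_weight valid_mt_init
      by (intro expectation_mono_finite fin) (simp add: p_def weight_spmf_def)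
    finally show ?thesis using s_le[OF that] by linarith
  qed
  then have "1 - weight_spmf (mt_transversal E B k R) \<le> 0"
    by (intro LIMSEQ_le_const[OF lim]) (auto intro!: exI[of _ 1])
  then show "lossless_spmf (mt_transversal E B k R)"
    using weight_spmf_le_1[of "mt_transversal E B k R"] by (simp add: lossless_spmf_def)
  define S where "S = (\<Sum>i\<in>{1..k}. real (card (B i \<inter> L)) / real b * z i
            * (\<Prod>j\<in>{1..<i}. 1 - real (card (B j \<inter> L)) / real b))"
  have "measure (measure_spmf (mt_transversal E B k R)) {T. L \<inter> T \<noteq> {}} - S \<le> C / real n"
    if "n > 0" for n
  proof -
    have eq: "chosen k -` {T. L \<inter> T \<noteq> {}} = {Y. \<exists>i\<in>{1..k}. Y i \<in> L}"
      by (auto simp: chosen_def)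
    have "measure (measure_spmf (mt_transversal E B k R)) {T. L \<inter> T \<noteq> {}}
        \<le> measure_pmf.expectation p (\<lambda>X. (\<Sum>i\<in>{1..k}. avoiding.potential L n i (first_hit L i) X)
            + survival n [] X)"
      unfolding tr eq using measure_hit_le valid_mt_init
      by (intro expectation_mono_finite fin) (simp add: p_def)
    also have "\<dots> = (\<Sum>i\<in>{1..k}. avoiding.mass L n {i} * avg {1..k} (first_hit L i) (\<lambda>_. undefined)) + s n"
      unfolding p_def expectation_mt_init s_def
      by (subst avg_add, simp, subst avg_sum, simp, subst avoiding.avg_potential, simp)
    also have "\<dots> \<le> (\<Sum>i\<in>{1..k}. z i * avg {1..k} (first_hit L i) (\<lambda>_. undefined)) + s n"
      by (intro add_right_mono sum_mono mult_right_mono z avg_nonneg) (auto simp: first_hit_def)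
    also have "(\<Sum>i\<in>{1..k}. z i * avg {1..k} (first_hit L i) (\<lambda>_. undefined)) = S"
      unfolding S_def by (intro sum.cong refl) (simp add: avg_first_hit del: One_nat_def)
    finally show ?thesis using s_le[OF that] by linarith
  qed
  then have "measure (measure_spmf (mt_transversal E B k R)) {T. L \<inter> T \<noteq> {}} - S \<le> 0"
    by (intro LIMSEQ_le_const[OF lim]) (auto intro!: exI[of _ 1])
  then show "measure (measure_spmf (mt_transversal E B k R)) {T. L \<inter> T \<noteq> {}}
      \<le> (\<Sum>i\<in>{1..k}. real (card (B i \<inter> L)) / real b * z i
            * (\<Prod>j\<in>{1..<i}. 1 - real (card (B j \<inter> L)) / real b))"
    by (simp add: S_def)
qed

end

subsection \<open>The extremal distribution of \<open>L\<close> over the blocks\<close>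

text \<open>The derivative of \<open>p \<mapsto> - ln (1 - p / (1 + p * x))\<close> is the reciprocal of a quadratic
  \<open>D\<close>, concave with \<open>D 0 = 1\<close>. So subtracting this function from a chord with slope at least 1
  gives a difference that first increases and then decreases.\<close>

lemma neg_ln_le_chord:
  fixes x p l c :: real
  defines "g \<equiv> \<lambda>t. ln (1 + t * x) - ln (1 - (1 - x) * t)"
  assumes x: "0 \<le> x" "x \<le> 1" and p: "0 \<le> p" "p \<le> l" and l: "l < 1"
    and c: "1 \<le> c" "g l \<le> c * l"
  shows "g p \<le> c * p"
proof (rule ccontr)
  define D where "D t = (1 + t * x) * (1 - (1 - x) * t)" for t
  define h where "h t = c * t - g t" for t
  assume "\<not> g p \<le> c * p"
  then have hp: "h p < 0" by (simp add: h_def)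
  have h0: "h 0 = 0" by (simp add: h_def g_def)
  have hl: "h l \<ge> 0" using c by (simp add: h_def)
  have pos: "0 < 1 + t * x" "0 < 1 - (1 - x) * t" if "0 \<le> t" "t \<le> l" for t
  proof -
    show "0 < 1 + t * x" using that x by (simp add: add_pos_nonneg)
    have "(1 - x) * t \<le> 1 * t" using that x by (intro mult_right_mono) auto
    then show "0 < 1 - (1 - x) * t" using that l by simp
  qed
  have deriv: "DERIV h t :> c - 1 / D t" if "0 \<le> t" "t \<le> l" for t
  proof -
    have "DERIV h t :> c - (x / (1 + t * x) - (x - 1) / (1 - (1 - x) * t))"
      unfolding h_def g_def using pos[OF that]
      by (auto intro!: derivative_eq_intros)
    also have "x / (1 + t * x) - (x - 1) / (1 - (1 - x) * t) = 1 / D t"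
      using pos[OF that] by (simp add: D_def field_simps)
    finally show ?thesis .
  qed
  have "p \<noteq> 0" "p \<noteq> l" using hp h0 hl by auto
  then have "0 < p" "p < l" using p by auto
  \<comment> \<open>As \<open>h 0 = 0\<close>, \<open>h p < 0\<close> and
    \<open>h l \<ge> 0\<close>, the mean value theorem gives a point before \<open>p\<close> where
    \<open>h\<close> falls and one after \<open>p\<close> where it rises.\<close>
  obtain u where u: "0 < u" "u < p" "h p - h 0 = (p - 0) * (c - 1 / D u)"
    using MVT2[OF \<open>0 < p\<close>, of h "\<lambda>t. c - 1 / D t"] deriv p by force
  obtain v where v: "p < v" "v < l" "h l - h p = (l - p) * (c - 1 / D v)"
    using MVT2[OF \<open>p < l\<close>, of h "\<lambda>t. c - 1 / D t"] deriv p by force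
  have Dpos: "D u > 0" "D v > 0"
    using u v p pos by (auto simp: D_def)
  have "c - 1 / D u < 0"
    using u hp h0 \<open>0 < p\<close> by (metis diff_0_right mult_less_0_iff not_less_iff_gr_or_eq)
  then have cu: "c * D u < 1" using Dpos by (simp add: field_simps)
  have "c - 1 / D v > 0"
    using v hp hl \<open>p < l\<close> by (metis diff_gt_0_iff_gt less_le_trans zero_less_mult_pos)
  then have cv: "c * D v > 1" using Dpos by (simp add: field_simps)
  \<comment> \<open>Concavity in explicit form: \<open>D u\<close> is at least the interpolation at
    \<open>u\<close> between \<open>D 0 = 1\<close> and \<open>D v\<close>. With
    \<open>c \<ge> 1\<close> this contradicts \<open>c * D u < 1 < c * D v\<close>.\<close>
  have "v * D u - u * D v = (v - u) * (1 + x * (1 - x) * (u * v))"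
    by (simp add: D_def algebra_simps)
  also have "\<dots> \<ge> (v - u) * 1"
    using u v x by (intro mult_left_mono) auto
  finally have "c * (v * D u - u * D v) \<ge> c * (v - u)"
    using c by (intro mult_left_mono) auto
  moreover have "c * (v - u) \<ge> 1 * (v - u)"
    using c u v by (intro mult_right_mono) auto
  moreover have "v * (c * D u) < v * 1" "u * (c * D v) > u * 1"
    using cu cv u v by (intro mult_strict_left_mono; simp)+
  ultimately show False by (simp add: algebra_simps)
qed

text \<open>Take logarithms and bound each \<open>g (p i)\<close> by a chord through the origin; the
  bounds add up because the \<open>p i\<close> sum to \<open>l\<close>.\<close>

lemma one_minus_prod_le_max:
  fixes x l :: real and p :: "nat \<Rightarrow> real"
  assumes x: "0 \<le> x" "x \<le> 1" and p: "\<And>i. i \<in> I \<Longrightarrow> 0 \<le> p i" and I: "finite I"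
    and l: "(\<Sum>i\<in>I. p i) = l" "l < 1"
  shows "1 - (\<Prod>i\<in>I. 1 - p i / (1 + p i * x)) \<le> max (l / (1 + l * x)) (1 - exp (- l))"
proof -
  define g where "g t = ln (1 + t * x) - ln (1 - (1 - x) * t)" for t
  have exp_g: "exp (- g t) = 1 - t / (1 + t * x)" if "0 \<le> t" "t < 1" for t
  proof -
    have "(1 - x) * t \<le> 1 * t" using that x by (intro mult_right_mono) auto
    then have "0 < 1 + t * x" "0 < 1 - (1 - x) * t"
      using that x by (simp_all add: add_pos_nonneg)
    then show ?thesis by (simp add: g_def exp_diff field_simps)
  qed
  have pl: "p i \<le> l" if "i \<in> I" for i
    using member_le_sum[OF that, of p] p I l by simp
  have "l \<ge> 0" using l p by (auto intro: sum_nonneg)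
  \<comment> \<open>The slope \<open>m / l\<close> has to be at least 1 and to reach
    \<open>g l\<close> at \<open>l\<close>. The case \<open>m = g l\<close> is that of a single
    block, \<open>m = l\<close> that of the evenly spread limit.\<close>
  define m where "m = max l (g l)"
  have chord: "l * g (p i) \<le> m * p i" if "i \<in> I" for i
  proof (cases "l = 0")
    case True
    then show ?thesis using pl[OF that] p[OF that] by simp
  next
    case False
    then have "l > 0" using \<open>l \<ge> 0\<close> by simp
    have "g (p i) \<le> m / l * p i"
      unfolding g_def
      by (rule neg_ln_le_chord[where l = l])
        (use x p[OF that] pl[OF that] l \<open>l > 0\<close> in \<open>auto simp: m_def g_def field_simps\<close>)
    then show ?thesis using \<open>l > 0\<close> by (simp add: field_simps)
  qed
  have "(\<Sum>i\<in>I. g (p i)) \<le> m"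
  proof (cases "l = 0")
    case True
    then have "p i = 0" if "i \<in> I" for i using pl[OF that] p[OF that] by simp
    then show ?thesis using \<open>l \<ge> 0\<close> by (simp add: g_def m_def le_max_iff_disj)
  next
    case False
    have "l * (\<Sum>i\<in>I. g (p i)) \<le> m * l"
      unfolding l(1)[symmetric] sum_distrib_left unfolding l(1) by (intro sum_mono chord)
    then show ?thesis using False \<open>l \<ge> 0\<close> by (simp add: mult.commute)
  qed
  then have "exp (- m) \<le> exp (- (\<Sum>i\<in>I. g (p i)))" by simp
  also have "\<dots> = (\<Prod>i\<in>I. exp (- g (p i)))"
    using I by (simp add: exp_sum sum_negf[symmetric])
  also have "\<dots> = (\<Prod>i\<in>I. 1 - p i / (1 + p i * x))"
    using pl p l by (intro prod.cong refl exp_g) force+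
  finally have "1 - (\<Prod>i\<in>I. 1 - p i / (1 + p i * x)) \<le> 1 - exp (- m)" by simp
  also have "\<dots> = max (1 - exp (- g l)) (1 - exp (- l))"
    by (simp add: m_def max_def)
  also have "1 - exp (- g l) = l / (1 + l * x)"
    using exp_g \<open>l \<ge> 0\<close> l(2) by simp
  finally show ?thesis .
qed

lemma sum_prod_telescope:
  fixes t :: "nat \<Rightarrow> real"
  shows "(\<Sum>i\<in>{1..k}. t i * (\<Prod>j\<in>{1..<i}. 1 - t j)) = 1 - (\<Prod>i\<in>{1..k}. 1 - t i)"
proof (induction k)
  case (Suc k)
  have "{1..<Suc k} = {1..k}" by auto
  then show ?case using Suc by (simp add: algebra_simps del: One_nat_def)
qed simp

theorem theorem6p3:
  fixes V L :: "'v set" and E :: "'v set set" and B :: "nat \<Rightarrow> 'v set"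
    and k b \<Delta> :: nat and R :: "'v rule" and \<alpha> :: real
  assumes "simple_graph V E"
    and "\<And>v. v \<in> V \<Longrightarrow> vertex_degree E v \<le> \<Delta>"
    and "block_partition V B k"
    and "\<And>i. i \<in> {1..k} \<Longrightarrow> card (B i) = b"
    and "b \<ge> 1"
    and "b \<ge> 4 * \<Delta>"
    and "\<alpha> = sqrt (1 - 4 * real \<Delta> / real b)"
    and "selection_rule E k R"
    and "L \<subseteq> V"
  shows "lossless_spmf (mt_transversal E B k R) \<and>
    measure (measure_spmf (mt_transversal E B k R)) {T. L \<inter> T \<noteq> {}}
      \<le> max (2 * real (card L) / (real b + real (card L) + (real b - real (card L)) * \<alpha>))
            (2 * (1 - exp (- (real (card L) / real b))) / (1 + \<alpha>))"
proof -
  have finV: "finite V" and edges: "\<And>e. e \<in> E \<Longrightarrow> e \<subseteq> V \<and> card e = 2"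
    using assms(1) by (auto simp: simple_graph_def)
  have V: "V = (\<Union>i\<in>{1..k}. B i)" and disj: "disjoint_family_on B {1..k}"
    using assms(3) by (auto simp: block_partition_def)
  have finE: "finite E"
    using edges finV by (intro finite_subset[of E "Pow V"]) auto
  interpret moser_tardos B k b E R
    using assms(4,5,8) disj finE edges by unfold_locales auto
  have b0: "real b > 0" using assms(5) by simp
  have \<alpha>: "0 \<le> \<alpha>" "\<alpha> \<le> 1" "\<alpha>\<^sup>2 = 1 - 4 * real \<Delta> / real b"
    using assms(6) b0 unfolding assms(7) by (auto simp: divide_simps)
  \<comment> \<open>\<open>y\<close> solves \<open>y = 1 + \<Delta> / b * y\<^sup>2\<close>, the
    fixed-point equation of the cluster expansion when no vertex is excluded; \<open>x\<close> is
    \<open>y - 1\<close>.\<close>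
  define y where "y = 2 / (1 + \<alpha>)"
  define x where "x = (1 - \<alpha>) / (1 + \<alpha>)"
  have x: "0 \<le> x" "x \<le> 1" and yx: "y = 1 + x"
    using \<alpha> by (auto simp: x_def y_def field_simps)
  have \<Delta>y: "real \<Delta> / real b * y\<^sup>2 = x"
  proof -
    have "real \<Delta> / real b = (1 - \<alpha>) * (1 + \<alpha>) / 4"
      using \<alpha>(3) by (simp add: power2_eq_square algebra_simps)
    then show ?thesis
      unfolding x_def y_def using \<alpha>(1) by (simp only:) (simp add: power2_eq_square divide_simps)
  qed
  have mass: "avoiding.mass M n {i} \<le> y / (1 + real (card (B i \<inter> M)) / real b * x)"
    if i: "i \<in> {1..k}" for M n i
  proof -
    define p where "p i = real (card (B i \<inter> M)) / real b" for i
    \<comment> \<open>In a block, \<open>z i\<close> solves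
      \<open>z i = 1 + (1 - p i) * \<Delta> / b * z i * y\<close>: a fraction \<open>1 - p i\<close>
      of block \<open>i\<close> lies off \<open>M\<close>, and the other block of an edge is charged
      the maximal value \<open>y\<close>.\<close>
    define z where "z j = (if j \<in> {1..k} then y / (1 + p j * x) else 1)" for j
    have p: "0 \<le> p j" "p j \<le> 1" if "j \<in> {1..k}" for j
      using card_mono[OF finite_block[OF that], of "B j \<inter> M"] card_block[OF that] b0
      by (auto simp: p_def)
    have px: "0 \<le> p j * x" "p j * x \<le> x" if "j \<in> {1..k}" for j
      using p[OF that] x by (auto simp: mult_left_le_one_le)
    have zy: "z j \<le> y" and z1: "1 \<le> z j" for j
      using px[of j] x by (auto simp: z_def yx field_simps)
    have "avoiding.mass M n {i} \<le> (\<Prod>i\<in>{i}. z i)"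
    proof (rule avoiding.mass_le)
      fix i assume i: "i \<in> {1..k}"
      let ?F = "{f. f \<in> cross_edges M \<and> i \<in> touched f}"
      have "?F \<subseteq> (\<Union>v\<in>B i - M. {e \<in> E. v \<in> e})"
        by (auto simp: cross_edges_def touched_def)
      then have "card ?F \<le> card (\<Union>v\<in>B i - M. {e \<in> E. v \<in> e})"
        using finE finite_block[OF i] by (intro card_mono) auto
      also have "\<dots> \<le> (\<Sum>v\<in>B i - M. card {e \<in> E. v \<in> e})"
        using finite_block[OF i] by (intro card_UN_le) auto
      also have "\<dots> \<le> (\<Sum>v\<in>B i - M. \<Delta>)"
      proof (intro sum_mono)
        fix v assume "v \<in> B i - M"
        then have "v \<in> V" using V i by blast
        then show "card {e \<in> E. v \<in> e} \<le> \<Delta>" using assms(2) by (simp add: vertex_degree_def)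
      qed
      also have "\<dots> = card (B i - M) * \<Delta>" by simp
      finally have "real (card ?F) \<le> real (card (B i - M)) * real \<Delta>"
        by (metis of_nat_le_iff of_nat_mult)
      also have "real (card (B i - M)) = real b * (1 - p i)"
      proof -
        have "card (B i - M) + card (B i \<inter> M) = b"
          using card_Int_Diff[OF finite_block[OF i], of M] card_block[OF i] by simp
        then have "real (card (B i - M)) = real b - real (card (B i \<inter> M))" by linarith
        then show ?thesis using b0 by (simp add: p_def right_diff_distrib)
      qed
      finally have cardF: "real (card ?F) \<le> real b * (1 - p i) * real \<Delta>" .
      have zij: "(\<Prod>j\<in>touched f. z j) \<le> z i * y" if f: "f \<in> ?F" for f
      proof -
        have "card (touched f) = 2" "i \<in> touched f" using f by (auto simp: cross_edges_def)
        then obtain j where "touched f = {i, j}" "i \<noteq> j"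
          by (metis card_2_iff doubleton_eq_iff insertE singletonD)
        then have "(\<Prod>j\<in>touched f. z j) = z i * z j" by simp
        also have "\<dots> \<le> z i * y" using zy z1[of i] by (intro mult_left_mono) auto
        finally show ?thesis .
      qed
      have "(\<Sum>f\<in>?F. 1 / real b ^ 2 * (\<Prod>j\<in>touched f. z j)) \<le> (\<Sum>f\<in>?F. 1 / real b ^ 2 * (z i * y))"
        by (intro sum_mono mult_left_mono zij) auto
      also have "\<dots> = real (card ?F) * (1 / real b ^ 2 * (z i * y))" by simp
      also have "\<dots> \<le> (real b * (1 - p i) * real \<Delta>) * (1 / real b ^ 2 * (z i * y))"
        using cardF z1[of i] x by (intro mult_right_mono) (auto simp: yx)
      also have "\<dots> = (1 - p i) * (real \<Delta> / real b * y\<^sup>2) / (1 + p i * x)"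
        using b0 i by (simp add: z_def power2_eq_square)
      also have "\<dots> = z i - 1"
        using i px[OF i] unfolding \<Delta>y by (simp add: z_def yx field_simps)
      finally show "1 + (\<Sum>f\<in>?F. 1 / real b ^ 2 * (\<Prod>j\<in>touched f. z j)) \<le> z i" by simp
    qed (use z1 i in auto)
    then show ?thesis using i by (simp add: z_def p_def)
  qed
  define p where "p i = real (card (B i \<inter> L)) / real b" for i
  define l where "l = real (card L) / real b"
  define t where "t i = p i / (1 + p i * x)" for i
  have p: "0 \<le> p i" "p i \<le> 1" if "i \<in> {1..k}" for i
    using card_mono[OF finite_block[OF that], of "B i \<inter> L"] card_block[OF that] b0
    by (auto simp: p_def)
  have "lossless_spmf (mt_transversal E B k R)"
    and bound: "measure (measure_spmf (mt_transversal E B k R)) {T. L \<inter> T \<noteq> {}}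
      \<le> (\<Sum>i\<in>{1..k}. p i * (y / (1 + p i * x)) * (\<Prod>j\<in>{1..<i}. 1 - p j))"
    using mt_transversal_bounds[of L "\<lambda>i. y / (1 + p i * x)" y] mass[of _ L] mass[of _ "{}"]
    by (simp_all add: p_def del: One_nat_def)
  let ?P = "measure (measure_spmf (mt_transversal E B k R)) {T. L \<inter> T \<noteq> {}}"
  have first: "2 * real (card L) / (real b + real (card L) + (real b - real (card L)) * \<alpha>)
      = y * (l / (1 + l * x))"
  proof -
    have pos: "real b + real (card L) + (real b - real (card L)) * \<alpha> > 0"
    proof -
      have "real (card L) * \<alpha> \<le> real (card L)" "real b * \<alpha> \<ge> 0"
        using \<alpha> by (auto simp: mult_left_le)
      then show ?thesis using b0 by (simp add: algebra_simps)
    qed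
    have "real b * (1 + \<alpha>) \<noteq> 0" using b0 \<alpha>(1) by simp
    then have "1 + l * x = (real b * (1 + \<alpha>) + real (card L) * (1 - \<alpha>)) / (real b * (1 + \<alpha>))"
      by (simp add: l_def x_def add_divide_distrib)
    also have "real b * (1 + \<alpha>) + real (card L) * (1 - \<alpha>)
        = real b + real (card L) + (real b - real (card L)) * \<alpha>"
      by (simp add: algebra_simps)
    finally have "1 + l * x = (real b + real (card L) + (real b - real (card L)) * \<alpha>)
        / (real b * (1 + \<alpha>))" .
    then show ?thesis
      using b0 \<alpha>(1) pos by (simp add: l_def y_def)
  qed
  have second: "2 * (1 - exp (- (real (card L) / real b))) / (1 + \<alpha>) = y * (1 - exp (- l))"
    by (simp add: y_def l_def)
  have "?P \<le> max (y * (l / (1 + l * x))) (y * (1 - exp (- l)))"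
  proof (cases "l < 1")
    case False
    \<comment> \<open>For \<open>l \<ge> 1\<close> the first term is already at least 1, because
      \<open>y = 1 + x\<close>.\<close>
    then have "1 \<le> y * (l / (1 + l * x))"
      using x by (simp add: yx field_simps add_pos_nonneg)
    then show ?thesis
      using measure_spmf.subprob_measure_le_1[of "mt_transversal E B k R" "{T. L \<inter> T \<noteq> {}}"]
      by linarith
  next
    case True
    have finL: "finite L" using finV assms(9) finite_subset by blast
    have "(\<Sum>i\<in>{1..k}. card (B i \<inter> L)) = card (\<Union>i\<in>{1..k}. B i \<inter> L)"
      using finL disj by (intro card_UN_disjoint[symmetric]) (auto simp: disjoint_family_on_def)
    also have "(\<Union>i\<in>{1..k}. B i \<inter> L) = L" using V assms(9) by auto
    finally have "(\<Sum>i\<in>{1..k}. real (card (B i \<inter> L))) = real (card L)"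
      by (metis of_nat_sum)
    then have sum_p: "(\<Sum>i\<in>{1..k}. p i) = l"
      by (simp add: p_def l_def sum_divide_distrib[symmetric])
    have t: "t i \<le> p i" "0 \<le> t i" if "i \<in> {1..k}" for i
      using p[OF that] x by (auto simp: t_def divide_le_eq mult_nonneg_nonneg add_pos_nonneg algebra_simps)
    \<comment> \<open>Enlarging the factors \<open>1 - p j\<close> to \<open>1 - t j\<close> makes
      them match the weights \<open>y * t i\<close>, and the sum telescopes.\<close>
    note bound
    also have "(\<Sum>i\<in>{1..k}. p i * (y / (1 + p i * x)) * (\<Prod>j\<in>{1..<i}. 1 - p j))
        \<le> (\<Sum>i\<in>{1..k}. y * (t i * (\<Prod>j\<in>{1..<i}. 1 - t j)))"
    proof (intro sum_mono)
      fix i assume i: "i \<in> {1..k}"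
      then have "{1..<i} \<subseteq> {1..k}" by auto
      then have "(\<Prod>j\<in>{1..<i}. 1 - p j) \<le> (\<Prod>j\<in>{1..<i}. 1 - t j)"
        using p t by (intro prod_mono) (auto simp: subset_iff)
      then have "y * t i * (\<Prod>j\<in>{1..<i}. 1 - p j) \<le> y * t i * (\<Prod>j\<in>{1..<i}. 1 - t j)"
        using t[OF i] x by (intro mult_left_mono) (auto simp: yx)
      then show "p i * (y / (1 + p i * x)) * (\<Prod>j\<in>{1..<i}. 1 - p j) \<le> y * (t i * (\<Prod>j\<in>{1..<i}. 1 - t j))"
        by (simp add: t_def mult.commute mult.left_commute)
    qed
    also have "\<dots> = y * (1 - (\<Prod>i\<in>{1..k}. 1 - p i / (1 + p i * x)))"
      unfolding sum_distrib_left[symmetric] sum_prod_telescope by (simp add: t_def)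
    also have "\<dots> \<le> y * max (l / (1 + l * x)) (1 - exp (- l))"
      using x p sum_p True by (intro mult_left_mono one_minus_prod_le_max) (auto simp: yx)
    also have "\<dots> = max (y * (l / (1 + l * x))) (y * (1 - exp (- l)))"
      using x by (simp add: max_mult_distrib_left yx)
    finally show ?thesis .
  qed
  with \<open>lossless_spmf (mt_transversal E B k R)\<close> show ?thesis
    unfolding first second by blast
qed

end
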